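(* Let $A$ and $B$ be finite non-collinear sets in $\mathbb{R}^2$ such that $|A|=b_A$ and $|B|=b_B$ (i.e. all points of $A$ and of $B$ lie on the boundaries of their convex hulls), and suppose that $2i_{A+B}\geq b_A+b_B-6$ fails to hold. Then either $|A|=3$ and $B$ is a translate of $A+A$, or $|B|=3$ and $A$ is a translate of $B+B$.
   Context: $A+B=\{a+b:a\in A,\ b\in B\}$; $[X]$ is the convex hull of $X$. For a finite non-collinear set $C\subset\mathbb{R}^2$, $b_C$ and $i_C$ denote the number of points of $C$ on the boundary $\partial[C]$ and in the interior of $[C]$, respectively. *)

theory Defs
  imports "HOL-Analysis.Analysis" "HOL-Library.Set_Algebras"
begin

definition boundary_count :: "(real^2) set \<Rightarrow> nat" where
  "boundary_count C = card (C \<inter> frontier (convex hull C))"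

definition interior_count :: "(real^2) set \<Rightarrow> nat" where
  "interior_count C = card (C \<inter> interior (convex hull C))"

definition is_translate_of :: "(real^2) set \<Rightarrow> (real^2) set \<Rightarrow> bool" where
  "is_translate_of X Y \<longleftrightarrow> (\<exists>t. X = (\<lambda>y. t + y) ` Y)"

end

theory Submission imports Defs
begin

text \<open>
  A sum \<open>a + b\<close> is interior to \<open>[A + B]\<close> unless \<open>a\<close> and \<open>b\<close> share an outer normal, so it suffices to
  count the sums of pairs without a common normal. Let \<open>|A| \<ge> |B|\<close>.

  \<^item> If an edge of \<open>[B]\<close> contains three points of \<open>B\<close>, an inner point of this edge summed with all of
    \<open>A\<close> off the parallel edge already gives enough interior sums (possibly after exchanging
    the roles of \<open>A\<close> and \<open>B\<close>).
  \<^item> Otherwise \<open>B\<close> is in strictly convex position. If \<open>|B| \<ge> 4\<close>, choose a generic direction whose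
    extreme points \<open>b+\<close>, \<open>b-\<close> in \<open>B\<close> are not adjacent, with extreme points \<open>a+\<close>, \<open>a-\<close> in \<open>A\<close>. The sums in
    \<open>(a+ + B) \<union> (A + b-)\<close> are distinct, as are those in \<open>(a- + B) \<union> (A + b+)\<close>. Almost every point shares a
    normal with at most one of the two opposite extreme points, so adding the two counts gives the bound.
  \<^item> If \<open>B\<close> is a triangle, sum each point of \<open>A\<close> with one suitable vertex of \<open>B\<close>. Three such sums coincide
    at most once, so about half of them are distinct; the bound fails only if \<open>A\<close> is a translate of \<open>B + B\<close>.
\<close>

section \<open>Faces and interior sums\<close>

definition face :: "(real^2) set \<Rightarrow> real^2 \<Rightarrow> (real^2) set" where
  "face S u = {x \<in> S. \<forall>y\<in>S. u \<bullet> y \<le> u \<bullet> x}"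

text \<open>The sum of such a pair lies on a supporting line of the hull of \<open>A + B\<close>.
  Since \<open>face S 0\<close> is all of \<open>S\<close>, only nonzero \<open>u\<close> carries
  information.\<close>

definition common_normal :: "(real^2) set \<Rightarrow> (real^2) set \<Rightarrow> real^2 \<Rightarrow> real^2 \<Rightarrow> bool" where
  "common_normal A B a b \<longleftrightarrow> (\<exists>u. u \<noteq> 0 \<and> a \<in> face A u \<and> b \<in> face B u)"

definition good_sums :: "(real^2) set \<Rightarrow> (real^2) set \<Rightarrow> (real^2) set" where
  "good_sums A B = {a + b | a b. a \<in> A \<and> b \<in> B \<and> \<not> common_normal A B a b}"

definition perp :: "real^2 \<Rightarrow> real^2" where
  "perp x = vector [- x $ 2, x $ 1]"

lemma inner_real2: "(x::real^2) \<bullet> y = x $ 1 * y $ 1 + x $ 2 * y $ 2"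
  by (simp add: inner_vec_def sum_2)

lemma perp_nth [simp]: "perp x $ 1 = - x $ 2" "perp x $ 2 = x $ 1"
  by (simp_all add: perp_def)

lemma inner_perp_same [simp]: "x \<bullet> perp x = 0" "perp x \<bullet> x = 0"
  by (simp_all add: inner_real2)

lemma perp_eq_0_iff [simp]: "perp x = 0 \<longleftrightarrow> x = 0"
  by (auto simp: vec_eq_iff forall_2)

lemma perp_basis:
  assumes "u \<noteq> 0"
  obtains \<alpha> \<beta> where "z = \<alpha> *\<^sub>R u + \<beta> *\<^sub>R perp u"
proof
  have n: "u $ 1 * u $ 1 + u $ 2 * u $ 2 \<noteq> 0"
    using assms inner_eq_zero_iff[of u] by (simp add: inner_real2)
  show "z = ((z \<bullet> u) / (u \<bullet> u)) *\<^sub>R u + ((z \<bullet> perp u) / (u \<bullet> u)) *\<^sub>R perp u"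
    using n by (simp add: vec_eq_iff forall_2 inner_real2 divide_simps) (auto simp: algebra_simps)
qed

lemma eq_if_inner_perp_eq:
  assumes "u \<noteq> 0" "u \<bullet> x = u \<bullet> y" "perp u \<bullet> x = perp u \<bullet> y"
  shows "x = y"
proof -
  obtain \<alpha> \<beta> where z: "x - y = \<alpha> *\<^sub>R u + \<beta> *\<^sub>R perp u" by (rule perp_basis[OF assms(1)])
  have "(x - y) \<bullet> (x - y) = \<alpha> * (u \<bullet> (x - y)) + \<beta> * (perp u \<bullet> (x - y))"
    by (subst (1) z) (simp add: inner_add_left)
  also have "\<dots> = 0" using assms by (simp add: inner_diff_right)
  finally show ?thesis by simp
qed

lemma faceD: "x \<in> face S u \<Longrightarrow> y \<in> S \<Longrightarrow> u \<bullet> y \<le> u \<bullet> x"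
  by (simp add: face_def)

lemma face_subset: "face S u \<subseteq> S"
  by (auto simp: face_def)

lemma face_eq: "x \<in> face S u \<Longrightarrow> y \<in> face S u \<Longrightarrow> u \<bullet> x = u \<bullet> y"
  by (force simp: face_def)

lemma face_mono: "x \<in> face S u \<Longrightarrow> y \<in> S \<Longrightarrow> u \<bullet> x \<le> u \<bullet> y \<Longrightarrow> y \<in> face S u"
  by (force simp: face_def)

lemma face_nonempty:
  assumes "finite S" "S \<noteq> {}"
  obtains x where "x \<in> face S u"
proof -
  obtain x where "x \<in> S" "u \<bullet> x = Max ((\<lambda>x. u \<bullet> x) ` S)"
    using Max_in[of "(\<lambda>x. u \<bullet> x) ` S"] assms by fastforce
  then have "x \<in> face S u" using assms by (auto simp: face_def)
  then show ?thesis by (rule that)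
qed

lemma face_cone:
  assumes "x \<in> face S u" "x \<in> face S u'" "0 \<le> \<alpha>" "0 \<le> \<beta>"
  shows "x \<in> face S (\<alpha> *\<^sub>R u + \<beta> *\<^sub>R u')"
  using assms by (auto simp: face_def inner_add_left intro!: add_mono mult_left_mono)

lemma face_scale: "0 < c \<Longrightarrow> face S (c *\<^sub>R u) = face S u"
  by (auto simp: face_def)

lemma noncollinear_not_constant:
  assumes "\<not> collinear S" "u \<noteq> (0::real^2)"
  obtains x y where "x \<in> S" "y \<in> S" "u \<bullet> x < u \<bullet> y"
proof -
  have "\<exists>x\<in>S. \<exists>y\<in>S. u \<bullet> x \<noteq> u \<bullet> y"
  proof (rule ccontr)
    assume c: "\<not> ?thesis"
    have "\<exists>c. x - y = c *\<^sub>R perp u" if "x \<in> S" "y \<in> S" for x y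
    proof -
      obtain \<alpha> \<beta> where z: "x - y = \<alpha> *\<^sub>R u + \<beta> *\<^sub>R perp u" by (rule perp_basis[OF assms(2)])
      have "u \<bullet> x = u \<bullet> y" using c that by blast
      then have "u \<bullet> (x - y) = 0" by (simp add: inner_diff_right)
      then have "\<alpha> = 0" using assms(2) by (simp add: z inner_add_right)
      then show ?thesis using z by auto
    qed
    then have "collinear S" unfolding collinear_def by blast
    then show False using assms by simp
  qed
  then show ?thesis using that by (metis linorder_less_linear)
qed

lemma noncollinear_face_opposite:
  assumes "\<not> collinear S" "u \<noteq> 0" "x \<in> face S u"
  shows "x \<notin> face S (- u)"
proof
  assume h: "x \<in> face S (- u)"
  obtain y z where "y \<in> S" "z \<in> S" "u \<bullet> y < u \<bullet> z" using noncollinear_not_constant assms by metis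
  then show False using faceD[OF h, of y] faceD[OF assms(3), of z] by simp
qed

section \<open>Supporting lines and interior points of the sumset\<close>

text \<open>A flat \<open>C\<close> lies in a line, whose normal serves as \<open>u\<close>.
  Otherwise \<open>z\<close> is separated from the interior, and the inequality passes to its
  closure, which contains \<open>C\<close>.\<close>

lemma support_at_noninterior_point:
  fixes C :: "(real^2) set"
  assumes "convex C" "z \<in> C" "z \<notin> interior C"
  obtains u where "u \<noteq> 0" "\<And>y. y \<in> C \<Longrightarrow> u \<bullet> y \<le> u \<bullet> z"
proof (cases "interior C = {}")
  case True
  obtain a b where ab: "a \<noteq> 0" "C \<subseteq> {x. a \<bullet> x = b}"
    by (rule empty_interior_subset_hyperplane[OF assms(1) True])
  then have "a \<bullet> y = b" if "y \<in> C" for y using that by blast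
  then show ?thesis using that[of a] ab(1) assms(2) by simp
next
  case False
  obtain a b where a: "a \<noteq> 0" "\<forall>x\<in>interior C. a \<bullet> x \<le> b" "\<forall>x\<in>{z}. b \<le> a \<bullet> x"
    using separating_hyperplane_sets[of "interior C" "{z}"] False assms convex_interior by auto
  have "C \<subseteq> closure (interior C)"
    using convex_closure_interior[OF assms(1) False] closure_subset by blast
  also have "\<dots> \<subseteq> {x. a \<bullet> x \<le> b}"
    using a by (intro closure_minimal) (auto simp: closed_halfspace_le)
  finally show ?thesis using that[of a] a by force
qed

text \<open>Equality of the cardinalities puts all of \<open>S\<close> on the frontier of its hull,
  so each point of \<open>S\<close> has a supporting line with normal \<open>u\<close>.\<close>

lemma frontier_point_face:
  assumes "finite S" "card S = boundary_count S" "x \<in> S"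
  obtains u where "u \<noteq> 0" "x \<in> face S u"
proof -
  have "S \<inter> frontier (convex hull S) = S"
    using assms by (intro card_subset_eq) (auto simp: boundary_count_def)
  then have "x \<notin> interior (convex hull S)" using assms by (auto simp: frontier_def)
  then obtain u where "u \<noteq> 0" "\<And>y. y \<in> convex hull S \<Longrightarrow> u \<bullet> y \<le> u \<bullet> x"
    using support_at_noninterior_point[of "convex hull S" x] hull_inc[OF assms(3)] convex_convex_hull
    by metis
  then show ?thesis using that[of u] assms(3) by (auto simp: face_def hull_inc)
qed

text \<open>A supporting functional at \<open>a + b\<close> is additive: fixing one summand and
  varying the other shows that it is maximal at \<open>a\<close> on \<open>A\<close> and at
  \<open>b\<close> on \<open>B\<close>.\<close>

lemma not_common_normal_imp_interior:
  assumes "a \<in> A" "b \<in> B" "\<not> common_normal A B a b"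
  shows "a + b \<in> interior (convex hull (A + B))"
proof (rule ccontr)
  assume "a + b \<notin> interior (convex hull (A + B))"
  moreover have "a + b \<in> A + B" using assms by (simp add: set_plus_intro)
  ultimately obtain u where u: "u \<noteq> 0" "\<And>y. y \<in> convex hull (A + B) \<Longrightarrow> u \<bullet> y \<le> u \<bullet> (a + b)"
    using support_at_noninterior_point[of "convex hull (A + B)" "a + b"] convex_convex_hull
    by (metis hull_inc)
  have le: "u \<bullet> (x + y) \<le> u \<bullet> (a + b)" if "x \<in> A" "y \<in> B" for x y
    using u(2) that by (simp add: hull_inc set_plus_intro)
  have "a \<in> face A u" "b \<in> face B u"
    using le[of _ b] le[of a] assms by (auto simp: face_def inner_add_right)
  then show False using assms u by (auto simp: common_normal_def)
qed

lemma good_sumsI: "a \<in> A \<Longrightarrow> b \<in> B \<Longrightarrow> \<not> common_normal A B a b \<Longrightarrow> a + b \<in> good_sums A B"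
  by (auto simp: good_sums_def)

lemma finite_good_sums: "finite A \<Longrightarrow> finite B \<Longrightarrow> finite (good_sums A B)"
  by (rule finite_subset[OF _ finite_set_plus[of A B]]) (auto simp: good_sums_def set_plus_intro)

lemma card_good_sums_le_interior_count:
  assumes "finite A" "finite B"
  shows "card (good_sums A B) \<le> interior_count (A + B)"
  unfolding interior_count_def
  using assms not_common_normal_imp_interior
  by (intro card_mono finite_Int disjI1 finite_set_plus) (auto simp: good_sums_def set_plus_intro)

lemma common_normal_commute: "common_normal A B a b \<longleftrightarrow> common_normal B A b a"
  by (auto simp: common_normal_def)

lemma good_sums_commute: "good_sums A B = good_sums B A"
  unfolding good_sums_def by (metis (no_types, lifting) add.commute common_normal_commute)

section \<open>Edges with at least three points\<close>

text \<open>An inner point of an edge has only the edge normal \<open>u\<close>, up to positive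
  factors, so its sums with all points of \<open>B\<close> off the parallel face are good. One inner
  point \<open>a2\<close> is summed with all of these, the other inner points with a single
  \<open>b0\<close>. The 3 accounts for the two ends of the edge and for \<open>a2\<close>, which is
  left out of the second family.\<close>

lemma good_sums_edge_bound:
  assumes fin: "finite A" "finite B" and ncA: "\<not> collinear A" and ncB: "\<not> collinear B"
    and u: "u \<noteq> 0" and q: "card (face A u) \<ge> 3"
  shows "card (face A u) + card B \<le> card (good_sums A B) + card (face B u) + 3"
proof -
  define h where "h = perp u"
  have finf: "finite (face A u)" "finite (face B u)" using fin face_subset finite_subset by metis+
  have inj: "x = y" if "x \<in> face S u \<and> y \<in> face S u \<or> x \<in> face S (-u) \<and> y \<in> face S (-u)"
      "h \<bullet> x = h \<bullet> y" for S x y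
    using that eq_if_inner_perp_eq[OF u, of x y] face_eq[of x S u y] face_eq[of x S "-u" y]
    by (auto simp: h_def)
  have ne: "face A u \<noteq> {}" using q by auto
  obtain x0 where x0: "x0 \<in> face (face A u) (- h)" using face_nonempty finf ne by metis
  obtain x1 where x1: "x1 \<in> face (face A u) h" using face_nonempty finf ne by metis
  have x01: "x0 \<in> face A u" "x1 \<in> face A u" using x0 x1 face_subset by blast+
  define I where "I = face A u - {x0, x1}"
  have I: "h \<bullet> x0 < h \<bullet> a" "h \<bullet> a < h \<bullet> x1" "a \<in> face A u" if "a \<in> I" for a
    using that x0 x1 x01 inj[of x0 A a] inj[of x1 A a] faceD[OF x0, of a] faceD[OF x1, of a]
    by (auto simp: I_def less_le)
  have cI: "card (face A u) \<le> card I + 2"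
  proof -
    have "card (face A u) - card {x0, x1} \<le> card I" unfolding I_def by (rule diff_card_le_card_Diff) simp
    moreover have "card {x0, x1} \<le> 2" by (simp add: card_insert_if)
    ultimately show ?thesis by linarith
  qed
  have finI: "finite I" using finf by (simp add: I_def)
  have "I \<noteq> {}" using cI q by auto
  then obtain a2 where a2: "a2 \<in> face I (- h)" using face_nonempty finI by metis
  then have a2I: "a2 \<in> I" using face_subset by blast
  have "B \<noteq> {}" using ncB by auto
  then obtain z where "z \<in> face B (- u)" using face_nonempty fin by metis
  \<comment> \<open>\<open>b0\<close> is the \<open>h\<close>-last point of the face opposite to
    \<open>u\<close>, while \<open>a2\<close> is the \<open>h\<close>-first inner point; these
    opposite choices make \<open>X\<close> and \<open>Y\<close> below disjoint.\<close>
  then obtain b0 where b0: "b0 \<in> face (face B (- u)) h"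
    using face_nonempty[of "face B (- u)" h] fin face_subset finite_subset by (metis empty_iff)
  then have b0f: "b0 \<in> face B (- u)" using face_subset by blast
  then have b0n: "b0 \<notin> face B u" using noncollinear_face_opposite[OF ncB u] by blast
  have good: "\<not> common_normal A B a b" if a: "a \<in> I" and b: "b \<notin> face B u" for a b
  proof
    assume "common_normal A B a b"
    then obtain v where v: "v \<noteq> 0" "a \<in> face A v" "b \<in> face B v" by (auto simp: common_normal_def)
    obtain \<alpha> \<beta> where vab: "v = \<alpha> *\<^sub>R u + \<beta> *\<^sub>R h" using perp_basis[OF u] h_def by metis
    have ua: "u \<bullet> x0 = u \<bullet> a" "u \<bullet> x1 = u \<bullet> a" using face_eq x01 I(3)[OF a] by metis+
    \<comment> \<open>In \<open>h\<close>, the inner point lies strictly between \<open>x0\<close>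
      and \<open>x1\<close>, which have the same \<open>u\<close>-value. A nonzero
      \<open>h\<close>-component of \<open>v\<close> would therefore prefer one of the ends.\<close>
    have "\<beta> * (h \<bullet> x0) \<le> \<beta> * (h \<bullet> a)" "\<beta> * (h \<bullet> x1) \<le> \<beta> * (h \<bullet> a)"
      using faceD[OF v(2), of x0] faceD[OF v(2), of x1] x01 face_subset[of A u] ua
      by (auto simp: vab inner_add_left)
    then have "\<beta> = 0" using I(1,2)[OF a]
      by (smt (verit, best) mult_le_cancel_left)
    then have v': "v = \<alpha> *\<^sub>R u" "\<alpha> \<noteq> 0" using vab v(1) by auto
    show False
    proof (cases "\<alpha> > 0")
      case True
      then show False using v(3) b face_scale v' by metis
    next
      case False
      then have "v = (- \<alpha>) *\<^sub>R (- u)" "0 < - \<alpha>" using v' by auto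
      then have "a \<in> face A (- u)" using v(2) face_scale by metis
      then show False using noncollinear_face_opposite[OF ncA u] I(3)[OF a] by blast
    qed
  qed
  define X where "X = (\<lambda>b. a2 + b) ` (B - face B u)"
  define Y where "Y = (\<lambda>a. a + b0) ` (I - {a2})"
  have "card X = card B - card (face B u)"
    unfolding X_def by (subst card_image) (auto simp: card_Diff_subset face_subset finf inj_on_def)
  moreover have "card Y = card I - 1"
    unfolding Y_def using a2I finI by (subst card_image) (auto simp: inj_on_def)
  moreover have "X \<inter> Y = {}"
  proof (rule ccontr)
    assume "X \<inter> Y \<noteq> {}"
    then obtain b a where ba: "b \<in> B" "a \<in> I" "a \<noteq> a2" "a2 + b = a + b0"
      by (auto simp: X_def Y_def)
    have "u \<bullet> a = u \<bullet> a2" using face_eq I(3) ba(2) a2I by metis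
    then have "u \<bullet> b = u \<bullet> b0" using arg_cong[OF ba(4), of "\<lambda>x. u \<bullet> x"] by (simp add: inner_add_right)
    then have bf: "b \<in> face B (- u)" using face_mono[OF b0f ba(1)] by simp
    have "h \<bullet> b \<le> h \<bullet> b0" using faceD[OF b0 bf] .
    moreover have "h \<bullet> a2 < h \<bullet> a"
      using faceD[OF a2 ba(2)] inj[of a A a2] I(3) ba(2,3) a2I by (force simp: less_le)
    ultimately show False using arg_cong[OF ba(4), of "\<lambda>x. h \<bullet> x"] by (simp add: inner_add_right)
  qed
  moreover have "X \<union> Y \<subseteq> good_sums A B"
  proof -
    have "I \<subseteq> A" using face_subset by (auto simp: I_def)
    moreover have "b0 \<in> B" using b0f face_subset by blast
    ultimately show ?thesis using good a2I b0n
      by (auto simp: X_def Y_def intro!: good_sumsI)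
  qed
  then have "card (X \<union> Y) \<le> card (good_sums A B)"
    using finite_good_sums fin card_mono by blast
  moreover have "finite X" "finite Y" using fin finI by (auto simp: X_def Y_def)
  ultimately have "card B - card (face B u) + (card I - 1) \<le> card (good_sums A B)"
    by (simp add: card_Un_disjoint)
  moreover have "card I \<ge> 1" using cI q by linarith
  ultimately show ?thesis using cI by linarith
qed

section \<open>Antipodal pairs\<close>

text \<open>The outer normals on one side of \<open>v\<close> are, up to scaling, \<open>s v - w\<close> with \<open>s\<close> real, so that they are
  linearly ordered by \<open>s\<close>; the other side is obtained by replacing \<open>w\<close> with \<open>- w\<close>.\<close>
locale antipodal =
  fixes A B :: "(real^2) set" and v w ap am bp bm :: "real^2"
  assumes finA: "finite A" and finB: "finite B"
    and sep: "\<And>x y. v \<bullet> x = v \<bullet> y \<Longrightarrow> w \<bullet> x = w \<bullet> y \<Longrightarrow> x = y"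
    and ap: "ap \<in> A" "\<And>a. a \<in> A \<Longrightarrow> a \<noteq> ap \<Longrightarrow> v \<bullet> a < v \<bullet> ap"
    and am: "am \<in> A" "\<And>a. a \<in> A \<Longrightarrow> a \<noteq> am \<Longrightarrow> v \<bullet> am < v \<bullet> a"
    and bp: "bp \<in> B" "\<And>b. b \<in> B \<Longrightarrow> b \<noteq> bp \<Longrightarrow> v \<bullet> b < v \<bullet> bp"
    and bm: "bm \<in> B" "\<And>b. b \<in> B \<Longrightarrow> b \<noteq> bm \<Longrightarrow> v \<bullet> bm < v \<bullet> b"
    and apm: "ap \<noteq> am" and bpm: "bp \<noteq> bm"
    and small: "\<And>s. card (face B (s *\<^sub>R v - w)) \<le> 2"
    and nonedge: "\<And>s. \<not> (bp \<in> face B (s *\<^sub>R v - w) \<and> bm \<in> face B (s *\<^sub>R v - w))"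
begin

abbreviation "M X s \<equiv> face X (s *\<^sub>R v - w)"

definition L :: "real^2 \<Rightarrow> real^2 \<Rightarrow> bool" where
  "L a b \<longleftrightarrow> (\<exists>s. a \<in> M A s \<and> b \<in> M B s)"

text \<open>The double conflicts of this side: \<open>DA\<close> and \<open>DB\<close> collect the
  points that share normals with both extreme points of the other set and so spoil a sum in each of
  the two families counted later.\<close>

definition DA where "DA = {a \<in> A - {ap, am}. L a bp \<and> L a bm}"
definition DB where "DB = {b \<in> B - {bp, bm}. L ap b \<and> L am b}"

text \<open>Raising \<open>s\<close> tilts the direction towards \<open>v\<close>, so the maximiser
  cannot move down in \<open>v\<close>. The proof adds the two optimality inequalities.\<close>

lemma M_mono:
  assumes "x \<in> M X s" "y \<in> M X t" "s < t"
  shows "v \<bullet> x \<le> v \<bullet> y"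
proof -
  have "x \<in> X" "y \<in> X" using assms face_subset by blast+
  then have "s * (v \<bullet> y) - w \<bullet> y \<le> s * (v \<bullet> x) - w \<bullet> x" "t * (v \<bullet> x) - w \<bullet> x \<le> t * (v \<bullet> y) - w \<bullet> y"
    using faceD[OF assms(1)] faceD[OF assms(2)] by (auto simp: inner_diff_left)
  then have "(t - s) * (v \<bullet> x) \<le> (t - s) * (v \<bullet> y)" by (simp add: algebra_simps)
  then show ?thesis using assms(3) by simp
qed

lemma M_interval:
  assumes "x \<in> M X s" "x \<in> M X t" "s \<le> r" "r \<le> t"
  shows "x \<in> M X r"
proof (cases "s = t")
  case False
  then have st: "s < t" using assms by simp
  define \<theta> where "\<theta> = (r - s) / (t - s)"
  have "\<theta> * (t - s) = r - s" using st by (simp add: \<theta>_def)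
  then have "r = (1 - \<theta>) * s + \<theta> * t" by (simp add: algebra_simps)
  moreover have "0 \<le> \<theta>" "0 \<le> 1 - \<theta>" using st assms by (auto simp: \<theta>_def)
  ultimately have \<theta>: "0 \<le> \<theta>" "0 \<le> 1 - \<theta>" "r = (1 - \<theta>) * s + \<theta> * t" by blast+
  have "(1 - \<theta>) *\<^sub>R (s *\<^sub>R v - w) + \<theta> *\<^sub>R (t *\<^sub>R v - w) = r *\<^sub>R v - w"
    by (simp add: \<theta>(3) algebra_simps)
  then show ?thesis using face_cone[OF assms(1,2) \<theta>(2,1)] by simp
qed (use assms in auto)

text \<open>Equal values in two of these directions fix both the \<open>v\<close>-value and the
  \<open>w\<close>-value; thus an edge has one normal per side.\<close>

lemma M_unique:
  assumes "x \<in> M X s" "x \<in> M X t" "y \<in> M X s" "y \<in> M X t" "s \<noteq> t"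
  shows "x = y"
proof -
  have e: "s * (v \<bullet> x) - w \<bullet> x = s * (v \<bullet> y) - w \<bullet> y" "t * (v \<bullet> x) - w \<bullet> x = t * (v \<bullet> y) - w \<bullet> y"
    using face_eq[OF assms(1,3)] face_eq[OF assms(2,4)] by (auto simp: inner_diff_left)
  then have "(s - t) * (v \<bullet> x) = (s - t) * (v \<bullet> y)" by (simp add: algebra_simps)
  then have "v \<bullet> x = v \<bullet> y" using assms(5) by simp
  moreover from this e have "w \<bullet> x = w \<bullet> y" by simp
  ultimately show ?thesis by (rule sep)
qed

lemma M_order: "x \<in> M X s \<Longrightarrow> y \<in> M X t \<Longrightarrow> v \<bullet> x < v \<bullet> y \<Longrightarrow> s \<le> t"
  using M_mono[of y X t x s] by linarith

lemma M_top_A: "x \<in> M A s \<Longrightarrow> ap \<in> M A t \<Longrightarrow> x \<noteq> ap \<Longrightarrow> s \<le> t"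
  by (rule M_order, assumption, assumption, rule ap(2), erule subsetD[OF face_subset])

lemma M_bot_A: "x \<in> M A s \<Longrightarrow> am \<in> M A t \<Longrightarrow> x \<noteq> am \<Longrightarrow> t \<le> s"
  by (rule M_order[of am], assumption, assumption, rule am(2), erule subsetD[OF face_subset])

lemma M_top_B: "x \<in> M B s \<Longrightarrow> bp \<in> M B t \<Longrightarrow> x \<noteq> bp \<Longrightarrow> s \<le> t"
  by (rule M_order, assumption, assumption, rule bp(2), erule subsetD[OF face_subset])

lemma M_bot_B: "x \<in> M B s \<Longrightarrow> bm \<in> M B t \<Longrightarrow> x \<noteq> bm \<Longrightarrow> t \<le> s"
  by (rule M_order[of bm], assumption, assumption, rule bm(2), erule subsetD[OF face_subset])

text \<open>All normals of \<open>q\<close> precede those of \<open>p\<close>, so the parameter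
  intervals of \<open>y\<close> and \<open>z\<close> both cover the gap in between. Points that
  share more than one normal are equal.\<close>

lemma double_unique:
  assumes "\<And>s t. p \<in> M X s \<Longrightarrow> q \<in> M X t \<Longrightarrow> t < s"
    and "p \<in> M X s1" "y \<in> M Y s1" "q \<in> M X s2" "y \<in> M Y s2"
    and "p \<in> M X t1" "z \<in> M Y t1" "q \<in> M X t2" "z \<in> M Y t2"
  shows "y = z"
proof -
  define \<sigma> \<tau> where "\<sigma> = max s2 t2" and "\<tau> = min s1 t1"
  have "\<sigma> < \<tau>" using assms(1)[OF assms(2,4)] assms(1)[OF assms(2,8)] assms(1)[OF assms(6,4)] assms(1)[OF assms(6,8)]
    by (auto simp: \<sigma>_def \<tau>_def)
  moreover have "y \<in> M Y \<sigma>" "y \<in> M Y \<tau>" "z \<in> M Y \<sigma>" "z \<in> M Y \<tau>"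
    using \<open>\<sigma> < \<tau>\<close> M_interval[OF assms(5,3)] M_interval[OF assms(9,7)]
    by (auto simp: \<sigma>_def \<tau>_def)
  ultimately show ?thesis using M_unique by (metis less_irrefl)
qed

text \<open>If \<open>ap\<close> and \<open>am\<close> lie on a common face at
  \<open>\<sigma>\<close>, then \<open>DA\<close> is empty and all other conflicts are forced onto
  \<open>M B \<sigma>\<close>, which has at most two points. If not, monotonicity allows one point
  each in \<open>DA\<close> and \<open>DB\<close>, and none at all once \<open>ap\<close> conflicts
  with \<open>bm\<close> or \<open>am\<close> with \<open>bp\<close>.\<close>

lemma side_bound:
  "card DA + card DB + of_bool (L ap bm) + of_bool (L am bp) \<le> 2"
proof (cases "\<exists>\<sigma>. ap \<in> M A \<sigma> \<and> am \<in> M A \<sigma>")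
  case True
  then obtain \<sigma> where \<sigma>: "ap \<in> M A \<sigma>" "am \<in> M A \<sigma>" by blast
  have DA: "DA = {}"
  proof (rule ccontr)
    assume "DA \<noteq> {}"
    then obtain a s1 s2 where a: "a \<noteq> ap" "a \<noteq> am" and s: "a \<in> M A s1" "bp \<in> M B s1" "a \<in> M A s2" "bm \<in> M B s2"
      by (auto simp: DA_def L_def)
    have "s1 \<le> \<sigma>" "\<sigma> \<le> s2" using M_top_A[OF s(1) \<sigma>(1)] M_bot_A[OF s(3) \<sigma>(2)] a by auto
    moreover have "s2 \<le> s1" using M_top_B[OF s(4,2)] bpm by auto
    ultimately have "s1 = s2" by simp
    then show False using nonedge s by blast
  qed
  have DBM: "b \<in> M B \<sigma>" if bDB: "b \<in> DB" for b
  proof -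
    obtain s1 s2 where s: "ap \<in> M A s1" "b \<in> M B s1" "am \<in> M A s2" "b \<in> M B s2"
      using bDB unfolding DB_def L_def by blast
    have "\<sigma> \<le> s1" using M_top_A[OF \<sigma>(2) s(1)] apm by auto
    moreover have "s2 \<le> \<sigma>" using M_top_A[OF s(3) \<sigma>(1)] apm by auto
    ultimately show ?thesis using M_interval s by blast
  qed
  show ?thesis
  proof (cases "DB = {}")
    case True
    then show ?thesis using DA by simp
  next
    case False
    then obtain b where b: "b \<in> DB" by blast
    then have bn: "b \<noteq> bp" "b \<noteq> bm" by (auto simp: DB_def)
    have 1: "bm \<in> M B \<sigma>" if Lb: "L ap bm"
    proof -
      obtain s where s: "ap \<in> M A s" "bm \<in> M B s" using Lb by (auto simp: L_def)
      have "\<sigma> \<le> s" using M_top_A[OF \<sigma>(2) s(1)] apm by auto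
      moreover have "s \<le> \<sigma>" using M_bot_B[OF DBM[OF b] s(2)] bn by auto
      ultimately show ?thesis using s by simp
    qed
    have 2: "bp \<in> M B \<sigma>" if Lb: "L am bp"
    proof -
      obtain s where s: "am \<in> M A s" "bp \<in> M B s" using Lb by (auto simp: L_def)
      have "s \<le> \<sigma>" using M_top_A[OF s(1) \<sigma>(1)] apm by auto
      moreover have "\<sigma> \<le> s" using M_top_B[OF DBM[OF b] s(2)] bn by auto
      ultimately show ?thesis using s by simp
    qed
    \<comment> \<open>The corner conflicts, when present, supply further points of
      \<open>M B \<sigma>\<close> outside \<open>DB\<close>, so \<open>small\<close> bounds all of
      them together.\<close>
    let ?E = "(if L ap bm then {bm} else {}) \<union> (if L am bp then {bp} else {})"
    have fDB: "finite DB" using finB by (simp add: DB_def)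
    have "DB \<inter> ?E = {}" by (auto simp: DB_def)
    then have "card (DB \<union> ?E) = card DB + card ?E"
      using fDB by (intro card_Un_disjoint) auto
    moreover have "card ?E = of_bool (L ap bm) + of_bool (L am bp)" using bpm by auto
    moreover have "DB \<union> ?E \<subseteq> M B \<sigma>" using DBM 1 2 by auto
    then have "card (DB \<union> ?E) \<le> card (M B \<sigma>)"
      by (rule card_mono[rotated]) (use finB face_subset finite_subset in metis)
    ultimately show ?thesis using small[of \<sigma>] DA by simp
  qed
next
  case False
  have A: "t < s" if "ap \<in> M A s" "am \<in> M A t" for s t
    using M_top_A[OF that(2,1)] apm False that by (cases "s = t") auto
  have B: "t < s" if "bp \<in> M B s" "bm \<in> M B t" for s t
    using M_top_B[OF that(2,1)] bpm nonedge that by (cases "s = t") auto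
  have "card DB \<le> 1"
  proof -
    have "b = b'" if bb: "b \<in> DB" "b' \<in> DB" for b b'
    proof -
      obtain s1 s2 where s: "ap \<in> M A s1" "b \<in> M B s1" "am \<in> M A s2" "b \<in> M B s2"
        using bb(1) unfolding DB_def L_def by blast
      obtain t1 t2 where t: "ap \<in> M A t1" "b' \<in> M B t1" "am \<in> M A t2" "b' \<in> M B t2"
        using bb(2) unfolding DB_def L_def by blast
      show ?thesis by (rule double_unique[OF A s t])
    qed
    moreover have "finite DB" using finB by (simp add: DB_def)
    ultimately show ?thesis by (metis One_nat_def card_le_Suc0_iff_eq)
  qed
  moreover have "card DA \<le> 1"
  proof -
    have "b = b'" if bb: "b \<in> DA" "b' \<in> DA" for b b'
    proof -
      obtain s1 s2 where s: "bp \<in> M B s1" "b \<in> M A s1" "bm \<in> M B s2" "b \<in> M A s2"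
        using bb(1) unfolding DA_def L_def by blast
      obtain t1 t2 where t: "bp \<in> M B t1" "b' \<in> M A t1" "bm \<in> M B t2" "b' \<in> M A t2"
        using bb(2) unfolding DA_def L_def by blast
      show ?thesis by (rule double_unique[OF B s t])
    qed
    moreover have "finite DA" using finA by (simp add: DA_def)
    ultimately show ?thesis by (metis One_nat_def card_le_Suc0_iff_eq)
  qed
  \<comment> \<open>A normal common to \<open>ap\<close> and \<open>bm\<close> at \<open>s\<close>
    bounds the normals of a point of \<open>DA\<close> by \<open>s\<close>; yet one of these also
    belongs to \<open>bp\<close>, whose normals lie beyond those of \<open>bm\<close>. The other
    three combinations are analogous.\<close>
  moreover have "DA = {} \<and> DB = {}" if "L ap bm \<or> L am bp"
  proof (rule ccontr)
    assume "\<not> (DA = {} \<and> DB = {})"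
    then consider (a) a s1 s2 where "a \<noteq> ap" "a \<noteq> am" "a \<in> M A s1" "bp \<in> M B s1" "a \<in> M A s2" "bm \<in> M B s2"
      | (b) b s1 s2 where "b \<noteq> bp" "b \<noteq> bm" "ap \<in> M A s1" "b \<in> M B s1" "am \<in> M A s2" "b \<in> M B s2"
      unfolding DA_def DB_def L_def by blast
    note cs = this
    from that consider (1) s where "ap \<in> M A s" "bm \<in> M B s" | (2) s where "am \<in> M A s" "bp \<in> M B s"
      unfolding L_def by blast
    then show False
    proof cases
      case (1 s)
      from cs show False
      proof cases
        case a
        have "s1 \<le> s" using M_top_A[OF a(3) 1(1)] a by auto
        then show False using B[OF a(4) 1(2)] by simp
      next
        case b
        have "s \<le> s2" using M_bot_B[OF b(6) 1(2)] b by auto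
        then show False using A[OF 1(1) b(5)] by simp
      qed
    next
      case (2 s)
      from cs show False
      proof cases
        case a
        have "s \<le> s2" using M_bot_A[OF a(5) 2(1)] a by auto
        then show False using B[OF 2(2) a(6)] by simp
      next
        case b
        have "s1 \<le> s" using M_top_B[OF b(4) 2(2)] b by auto
        then show False using A[OF b(3) 2(1)] by simp
      qed
    qed
  qed
  ultimately show ?thesis by (cases "L ap bm \<or> L am bp") auto
qed

end

section \<open>Counting sums over two opposite corner pairs\<close>

text \<open>Each of the families \<open>(ap + B) \<union> (A + bm)\<close> and
  \<open>(am + B) \<union> (A + bp)\<close> has \<open>card A + card B - 1\<close> members. Both
  lose \<open>ap + bp\<close> and \<open>am + bm\<close>. Each non-extreme point costs one sum over
  both families, except that double conflicts cost two; together with the corner conflicts this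
  excess is at most 2 on each side of \<open>v\<close>.\<close>

lemma antipodal_bound:
  fixes v :: "real^2"
  assumes finA: "finite A" and finB: "finite B" and ncA: "\<not> collinear A" and ncB: "\<not> collinear B"
    and v: "v \<noteq> 0"
    and ap: "ap \<in> A" "\<And>a. a \<in> A \<Longrightarrow> a \<noteq> ap \<Longrightarrow> v \<bullet> a < v \<bullet> ap"
    and am: "am \<in> A" "\<And>a. a \<in> A \<Longrightarrow> a \<noteq> am \<Longrightarrow> v \<bullet> am < v \<bullet> a"
    and bp: "bp \<in> B" "\<And>b. b \<in> B \<Longrightarrow> b \<noteq> bp \<Longrightarrow> v \<bullet> b < v \<bullet> bp"
    and bm: "bm \<in> B" "\<And>b. b \<in> B \<Longrightarrow> b \<noteq> bm \<Longrightarrow> v \<bullet> bm < v \<bullet> b"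
    and small: "\<And>u. u \<noteq> 0 \<Longrightarrow> card (face B u) \<le> 2"
    and nonedge: "\<And>u. u \<noteq> 0 \<Longrightarrow> \<not> (bp \<in> face B u \<and> bm \<in> face B u)"
    and apm: "ap \<noteq> am" and bpm: "bp \<noteq> bm"
  shows "card A + card B \<le> 2 * card (good_sums A B) + 6"
proof -
  have "(s *\<^sub>R v - perp v) \<bullet> perp v \<noteq> 0" "(s *\<^sub>R v - (- perp v)) \<bullet> perp v \<noteq> 0" for s
    using v by (simp_all add: inner_add_left inner_diff_left)
  then have nz: "s *\<^sub>R v - perp v \<noteq> 0" "s *\<^sub>R v - (- perp v) \<noteq> 0" for s
    by (metis inner_zero_left)+
  interpret l: antipodal A B v "perp v" ap am bp bm
    by unfold_locales
      (fact finA finB ap am bp bm apm bpm small[OF nz(1)] nonedge[OF nz(1)] |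
       simp add: eq_if_inner_perp_eq[OF v])+
  interpret r: antipodal A B v "- perp v" ap am bp bm
    by unfold_locales
      (fact finA finB ap am bp bm apm bpm small[OF nz(2)] nonedge[OF nz(2)] |
       simp add: eq_if_inner_perp_eq[OF v])+
  \<comment> \<open>The component of the shared normal along \<open>perp v\<close> decides: negative
    gives the side \<open>l\<close>, positive the side \<open>r\<close>, and zero leaves
    \<open>v\<close> or \<open>- v\<close>, attained only at the extreme points.\<close>
  have badD: "(a = ap \<and> b = bp) \<or> (a = am \<and> b = bm) \<or> l.L a b \<or> r.L a b"
    if badab: "common_normal A B a b" for a b
  proof -
    obtain u where u: "u \<noteq> 0" "a \<in> face A u" "b \<in> face B u" using badab by (auto simp: common_normal_def)
    obtain \<alpha> \<beta> where uab: "u = \<alpha> *\<^sub>R v + \<beta> *\<^sub>R perp v" by (rule perp_basis[OF v])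
    consider "\<beta> < 0" | "\<beta> > 0" | "\<beta> = 0" "\<alpha> > 0" | "\<beta> = 0" "\<alpha> < 0" using u(1) uab by force
    then show ?thesis
    proof cases
      case 1
      then have "u = (- \<beta>) *\<^sub>R ((\<alpha> / (- \<beta>)) *\<^sub>R v - perp v)"
        by (simp add: uab scaleR_right_diff_distrib)
      then have "l.L a b" using u 1 face_scale[of "- \<beta>"] unfolding l.L_def by (metis neg_0_less_iff_less)
      then show ?thesis by simp
    next
      case 2
      then have "u = \<beta> *\<^sub>R ((\<alpha> / \<beta>) *\<^sub>R v - (- perp v))"
        by (simp add: uab scaleR_right_distrib)
      then have "r.L a b" using u 2 face_scale[of \<beta>] unfolding r.L_def by metis
      then show ?thesis by simp
    next
      case 3
      then have "a \<in> face A v" "b \<in> face B v" using u uab face_scale[of \<alpha>] by auto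
      then have "a = ap" "b = bp" using ap bp by (force simp: face_def)+
      then show ?thesis by simp
    next
      case 4
      then have "u = (- \<alpha>) *\<^sub>R (- v)" "0 < - \<alpha>" using uab by auto
      then have "a \<in> face A (- v)" "b \<in> face B (- v)" using u face_scale by metis+
      then have "a = am" "b = bm" using am bm by (force simp: face_def)+
      then show ?thesis by simp
    qed
  qed
  \<comment> \<open>Two normals from different sides add up to a multiple of \<open>v\<close>. A
    point strictly between \<open>m\<close> and \<open>p\<close> in \<open>v\<close> forces this
    multiple to be 0, so the normals are opposite.\<close>
  have sides: "\<not> (x \<in> face S (s *\<^sub>R v - perp v) \<and> x \<in> face S (t *\<^sub>R v - (- perp v)))"
    if nc: "\<not> collinear S" and pm: "p \<in> S" "m \<in> S" "v \<bullet> x < v \<bullet> p" "v \<bullet> m < v \<bullet> x" for S x s t p m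
  proof
    assume "x \<in> face S (s *\<^sub>R v - perp v) \<and> x \<in> face S (t *\<^sub>R v - (- perp v))"
    then have x: "x \<in> face S (s *\<^sub>R v - perp v)" "x \<in> face S (t *\<^sub>R v - (- perp v))" by auto
    have *: "(s + t) * (v \<bullet> y) \<le> (s + t) * (v \<bullet> x)" if "y \<in> S" for y
      using faceD[OF x(1) that] faceD[OF x(2) that]
      by (simp add: inner_diff_left inner_add_left algebra_simps)
    have "s + t = 0" using *[OF pm(1)] *[OF pm(2)] pm(3,4) by (smt (verit) mult_le_cancel_left)
    then have "t *\<^sub>R v - (- perp v) = - (s *\<^sub>R v - perp v)"
      by (simp add: eq_neg_iff_add_eq_0 scaleR_add_left[symmetric])
    then show False using noncollinear_face_opposite[OF nc nz(1) x(1)] x(2) by simp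
  qed
  define A' where "A' = A - {ap, am}"
  define B' where "B' = B - {bp, bm}"
  define \<beta>1 \<beta>2 \<alpha>1 \<alpha>2 where
    "\<beta>1 = {b \<in> B'. common_normal A B ap b}" and "\<beta>2 = {b \<in> B'. common_normal A B am b}" and
    "\<alpha>1 = {a \<in> A'. common_normal A B a bm}" and "\<alpha>2 = {a \<in> A'. common_normal A B a bp}"
  note defs = \<beta>1_def \<beta>2_def \<alpha>1_def \<alpha>2_def
  have fin: "finite A'" "finite B'" "finite \<beta>1" "finite \<beta>2" "finite \<alpha>1" "finite \<alpha>2"
    using finA finB by (auto simp: defs A'_def B'_def)
  have "card (S - {x, y}) + 2 = card S" if "finite S" "x \<in> S" "y \<in> S" "x \<noteq> y" for S and x y :: "real^2"
    using card_mono[of S "{x, y}"] that by (simp add: card_Diff_subset)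
  then have cA': "card A' + 2 = card A" and cB': "card B' + 2 = card B"
    using ap(1) am(1) bp(1) bm(1) apm bpm finA finB by (auto simp: A'_def B'_def)
  have LR_A: "\<not> (l.L a x \<and> r.L a y)" if "a \<in> A'" for a x y
    using sides[OF ncA ap(1) am(1), of a] that ap(2)[of a] am(2)[of a]
    unfolding l.L_def r.L_def A'_def by blast
  have LR_B: "\<not> (l.L x b \<and> r.L y b)" if "b \<in> B'" for b x y
    using sides[OF ncB bp(1) bm(1), of b] that bp(2)[of b] bm(2)[of b]
    unfolding l.L_def r.L_def B'_def by blast
  have "\<beta>1 \<inter> \<beta>2 \<subseteq> l.DB \<union> r.DB"
    using badD LR_B unfolding l.DB_def r.DB_def defs B'_def by blast
  then have "card (\<beta>1 \<inter> \<beta>2) \<le> card (l.DB \<union> r.DB)"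
    using finB by (intro card_mono) (auto simp: l.DB_def r.DB_def)
  then have \<beta>12: "card (\<beta>1 \<inter> \<beta>2) \<le> card l.DB + card r.DB" using card_Un_le order_trans by blast
  have "\<alpha>1 \<inter> \<alpha>2 \<subseteq> l.DA \<union> r.DA"
    using badD LR_A unfolding l.DA_def r.DA_def defs A'_def by blast
  then have "card (\<alpha>1 \<inter> \<alpha>2) \<le> card (l.DA \<union> r.DA)"
    using finA by (intro card_mono) (auto simp: l.DA_def r.DA_def)
  then have \<alpha>12: "card (\<alpha>1 \<inter> \<alpha>2) \<le> card l.DA + card r.DA" using card_Un_le order_trans by blast
  have "card \<beta>1 + card \<beta>2 = card (\<beta>1 \<union> \<beta>2) + card (\<beta>1 \<inter> \<beta>2)"
    "card \<alpha>1 + card \<alpha>2 = card (\<alpha>1 \<union> \<alpha>2) + card (\<alpha>1 \<inter> \<alpha>2)"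
    using fin card_Un_Int by blast+
  moreover have "card (\<beta>1 \<union> \<beta>2) \<le> card B'" "card (\<alpha>1 \<union> \<alpha>2) \<le> card A'"
    using fin by (auto simp: defs intro!: card_mono)
  ultimately have inner:
    "card \<beta>1 + card \<beta>2 \<le> card B' + (card l.DB + card r.DB)"
    "card \<alpha>1 + card \<alpha>2 \<le> card A' + (card l.DA + card r.DA)"
    using \<beta>12 \<alpha>12 by linarith+
  have corner: "of_bool (common_normal A B ap bm) \<le> of_bool (l.L ap bm) + (of_bool (r.L ap bm) :: nat)"
    "of_bool (common_normal A B am bp) \<le> of_bool (l.L am bp) + (of_bool (r.L am bp) :: nat)"
    using badD[of ap bm] badD[of am bp] apm bpm by auto
  have 1: "card {b \<in> B. \<not> common_normal A B x b} + (of_bool (common_normal A B x y) + card {b \<in> B'. common_normal A B x b} + 1) \<ge> card B"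
    if "{y, z} = {bp, bm}" for x y z
  proof -
    have "B \<subseteq> {b \<in> B. \<not> common_normal A B x b} \<union> ((if common_normal A B x y then {y} else {}) \<union> ({b \<in> B'. common_normal A B x b} \<union> {z}))"
      using that by (auto simp: B'_def)
    then have "card B \<le> card ({b \<in> B. \<not> common_normal A B x b} \<union> ((if common_normal A B x y then {y} else {}) \<union> ({b \<in> B'. common_normal A B x b} \<union> {z})))"
      using finB fin by (intro card_mono) auto
    also have "\<dots> \<le> card {b \<in> B. \<not> common_normal A B x b} + (card (if common_normal A B x y then {y} else {}) + (card {b \<in> B'. common_normal A B x b} + card {z}))"
      by (intro order_trans[OF card_Un_le] add_mono order_refl)
    finally show ?thesis by (auto split: if_splits)
  qed
  have 2: "card {a \<in> A - {x}. \<not> common_normal A B a y} + card {a \<in> A'. common_normal A B a y} + 2 \<ge> card A"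
    if "{x, z} = {ap, am}" for x y z
  proof -
    have "A \<subseteq> {a \<in> A - {x}. \<not> common_normal A B a y} \<union> ({a \<in> A'. common_normal A B a y} \<union> {x, z})"
      using that by (auto simp: A'_def)
    then have "card A \<le> card ({a \<in> A - {x}. \<not> common_normal A B a y} \<union> ({a \<in> A'. common_normal A B a y} \<union> {x, z}))"
      using finA fin by (intro card_mono) auto
    also have "\<dots> \<le> card {a \<in> A - {x}. \<not> common_normal A B a y} + (card {a \<in> A'. common_normal A B a y} + card {x, z})"
      by (intro order_trans[OF card_Un_le] add_mono order_refl)
    also have "card {x, z} \<le> 2" by (simp add: card_insert_if)
    finally show ?thesis by simp
  qed
  \<comment> \<open>The two parts of a family are separated by \<open>v\<close>, so no sum occurs in
    both; \<open>x\<close> is omitted from the second part because \<open>x + y\<close> belongs to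
    the first.\<close>
  have 3: "card {b \<in> B. \<not> common_normal A B x b} + card {a \<in> A - {x}. \<not> common_normal A B a y} \<le> card (good_sums A B)"
    if xy: "x \<in> A" "y \<in> B"
      "(\<forall>a\<in>A. \<forall>b\<in>B. a \<noteq> x \<longrightarrow> v \<bullet> (a + y) < v \<bullet> (x + b)) \<or>
       (\<forall>a\<in>A. \<forall>b\<in>B. a \<noteq> x \<longrightarrow> v \<bullet> (x + b) < v \<bullet> (a + y))" for x y
  proof -
    let ?X = "(\<lambda>b. x + b) ` {b \<in> B. \<not> common_normal A B x b}"
    let ?Y = "(\<lambda>a. a + y) ` {a \<in> A - {x}. \<not> common_normal A B a y}"
    have "?X \<inter> ?Y = {}"
    proof (rule ccontr)
      assume "?X \<inter> ?Y \<noteq> {}"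
      then obtain a b where "a \<in> A" "b \<in> B" "a \<noteq> x" "x + b = a + y" by blast
      then show False using xy(3) by (metis less_irrefl)
    qed
    then have "card (?X \<union> ?Y) = card ?X + card ?Y" using finA finB by (intro card_Un_disjoint) auto
    moreover have "card ?X = card {b \<in> B. \<not> common_normal A B x b}" by (intro card_image) (auto simp: inj_on_def)
    moreover have "card ?Y = card {a \<in> A - {x}. \<not> common_normal A B a y}" by (intro card_image) (auto simp: inj_on_def)
    moreover have "?X \<union> ?Y \<subseteq> good_sums A B" using xy by (auto intro: good_sumsI)
    then have "card (?X \<union> ?Y) \<le> card (good_sums A B)"
      by (intro card_mono finite_good_sums finA finB)
    ultimately show ?thesis by simp
  qed
  have leB: "v \<bullet> bm \<le> v \<bullet> b" "v \<bullet> b \<le> v \<bullet> bp" if "b \<in> B" for b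
    using bm(2)[OF that] bp(2)[OF that] by (cases "b = bm"; cases "b = bp"; force)+
  have "card {b \<in> B. \<not> common_normal A B ap b} + card {a \<in> A - {ap}. \<not> common_normal A B a bm} \<le> card (good_sums A B)"
    using leB ap(2) by (intro 3 ap(1) bm(1) disjI1) (auto simp: inner_add_right intro: add_less_le_mono)
  moreover have "card {b \<in> B. \<not> common_normal A B am b} + card {a \<in> A - {am}. \<not> common_normal A B a bp} \<le> card (good_sums A B)"
    using leB am(2) by (intro 3 am(1) bp(1) disjI2) (auto simp: inner_add_right intro: add_less_le_mono)
  moreover have "card {b \<in> B. \<not> common_normal A B ap b} + (of_bool (common_normal A B ap bm) + card \<beta>1 + 1) \<ge> card B"
    "card {b \<in> B. \<not> common_normal A B am b} + (of_bool (common_normal A B am bp) + card \<beta>2 + 1) \<ge> card B"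
    unfolding defs by (rule 1, blast)+
  moreover have "card {a \<in> A - {ap}. \<not> common_normal A B a bm} + card \<alpha>1 + 2 \<ge> card A"
    "card {a \<in> A - {am}. \<not> common_normal A B a bp} + card \<alpha>2 + 2 \<ge> card A"
    unfolding defs by (rule 2, blast)+
  ultimately show ?thesis using inner corner l.side_bound r.side_bound cA' cB' by linarith
qed

section \<open>Generic directions\<close>

text \<open>A small multiple of \<open>h\<close> breaks the ties of \<open>u\<close> and keeps its
  strict inequalities; as the pairs are finitely many, one \<open>\<epsilon>\<close> realises the
  lexicographic order.\<close>

lemma perturb_functional:
  fixes u h :: "real^2"
  assumes "finite S"
  obtains \<epsilon> where "\<epsilon> > 0" "\<And>x y. x \<in> S \<Longrightarrow> y \<in> S \<Longrightarrow> u \<bullet> x < u \<bullet> y \<or> u \<bullet> x = u \<bullet> y \<and> h \<bullet> x < h \<bullet> y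
    \<Longrightarrow> (u + \<epsilon> *\<^sub>R h) \<bullet> x < (u + \<epsilon> *\<^sub>R h) \<bullet> y"
proof -
  have pair: "\<forall>\<^sub>F \<epsilon> in at_right 0. u \<bullet> x < u \<bullet> y \<or> u \<bullet> x = u \<bullet> y \<and> h \<bullet> x < h \<bullet> y
    \<longrightarrow> (u + \<epsilon> *\<^sub>R h) \<bullet> x < (u + \<epsilon> *\<^sub>R h) \<bullet> y" for x y
  proof (cases "u \<bullet> x < u \<bullet> y")
    case True
    have "((\<lambda>\<epsilon>. (u \<bullet> y - u \<bullet> x) + \<epsilon> * (h \<bullet> y - h \<bullet> x)) \<longlongrightarrow> (u \<bullet> y - u \<bullet> x) + 0 * (h \<bullet> y - h \<bullet> x)) (at_right 0)"
      by (intro tendsto_intros)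
    then have "\<forall>\<^sub>F \<epsilon> in at_right 0. 0 < (u \<bullet> y - u \<bullet> x) + \<epsilon> * (h \<bullet> y - h \<bullet> x)"
      using True by (intro order_tendstoD(1)) auto
    then show ?thesis by eventually_elim (simp add: inner_add_left algebra_simps)
  next
    case False
    have "\<forall>\<^sub>F \<epsilon>::real in at_right 0. 0 < \<epsilon>" by (rule eventually_at_right_less)
    then show ?thesis by eventually_elim (use False in \<open>auto simp: inner_add_left\<close>)
  qed
  have "\<forall>\<^sub>F \<epsilon> in at_right 0. \<forall>x\<in>S. \<forall>y\<in>S. u \<bullet> x < u \<bullet> y \<or> u \<bullet> x = u \<bullet> y \<and> h \<bullet> x < h \<bullet> y
    \<longrightarrow> (u + \<epsilon> *\<^sub>R h) \<bullet> x < (u + \<epsilon> *\<^sub>R h) \<bullet> y"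
    using assms pair by (auto intro!: eventually_ball_finite)
  moreover have "\<forall>\<^sub>F \<epsilon>::real in at_right 0. 0 < \<epsilon>" by (rule eventually_at_right_less)
  ultimately have "\<forall>\<^sub>F \<epsilon> in at_right 0. 0 < \<epsilon> \<and> (\<forall>x\<in>S. \<forall>y\<in>S. u \<bullet> x < u \<bullet> y \<or> u \<bullet> x = u \<bullet> y \<and> h \<bullet> x < h \<bullet> y
    \<longrightarrow> (u + \<epsilon> *\<^sub>R h) \<bullet> x < (u + \<epsilon> *\<^sub>R h) \<bullet> y)"
    by eventually_elim auto
  then obtain \<epsilon> where "0 < \<epsilon>" "\<forall>x\<in>S. \<forall>y\<in>S. u \<bullet> x < u \<bullet> y \<or> u \<bullet> x = u \<bullet> y \<and> h \<bullet> x < h \<bullet> y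
    \<longrightarrow> (u + \<epsilon> *\<^sub>R h) \<bullet> x < (u + \<epsilon> *\<^sub>R h) \<bullet> y"
    using eventually_happens trivial_limit_at_right_real by blast
  then show ?thesis using that by blast
qed

text \<open>Perturbing \<open>u\<close> towards \<open>h\<close> separates all points of
  \<open>A \<union> B\<close> and makes \<open>p\<close> and \<open>r\<close> the top and bottom of
  \<open>B\<close>, so the counting bound applies to lexicographic extremes that share no
  face.\<close>

lemma antipodal_bound_lex:
  assumes finA: "finite A" and finB: "finite B" and ncA: "\<not> collinear A" and ncB: "\<not> collinear B"
    and small: "\<And>u. u \<noteq> 0 \<Longrightarrow> card (face B u) \<le> 2"
    and u: "u \<noteq> 0" and h: "h = perp u \<or> h = - perp u"
    and p: "p \<in> face (face B u) h" and r: "r \<in> face (face B (- u)) (- h)"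
    and nonedge: "\<And>u. u \<noteq> 0 \<Longrightarrow> \<not> (p \<in> face B u \<and> r \<in> face B u)"
  shows "card A + card B \<le> 2 * card (good_sums A B) + 6"
proof -
  obtain \<epsilon> where \<epsilon>: "\<epsilon> > 0" "\<And>x y. x \<in> A \<union> B \<Longrightarrow> y \<in> A \<union> B \<Longrightarrow> u \<bullet> x < u \<bullet> y \<or> u \<bullet> x = u \<bullet> y \<and> h \<bullet> x < h \<bullet> y
    \<Longrightarrow> (u + \<epsilon> *\<^sub>R h) \<bullet> x < (u + \<epsilon> *\<^sub>R h) \<bullet> y"
    using perturb_functional[of "A \<union> B" u h] finA finB by auto
  define v where "v = u + \<epsilon> *\<^sub>R h"
  note lex = \<epsilon>(2)[folded v_def]
  have sep: "u \<bullet> x \<noteq> u \<bullet> y \<or> h \<bullet> x \<noteq> h \<bullet> y" if "x \<noteq> y" for x y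
    using that eq_if_inner_perp_eq[OF u, of x y] h by auto
  have inj: "v \<bullet> x \<noteq> v \<bullet> y" if "x \<in> A \<union> B" "y \<in> A \<union> B" "x \<noteq> y" for x y
    using lex[OF that(1,2)] lex[OF that(2,1)] sep[OF that(3)] by force
  have pB: "p \<in> face B u" "r \<in> face B (- u)" "p \<in> B" "r \<in> B" using p r face_subset by blast+
  have pr: "p \<noteq> r" using noncollinear_face_opposite[OF ncB u pB(1)] pB(2) by auto
  have "v \<noteq> 0" using inj[of p r] pB pr by auto
  have p2: "v \<bullet> b < v \<bullet> p" if "b \<in> B" "b \<noteq> p" for b
  proof -
    have "u \<bullet> b \<le> u \<bullet> p" using faceD[OF pB(1) that(1)] .
    moreover have "h \<bullet> b < h \<bullet> p" if "u \<bullet> b = u \<bullet> p"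
      using faceD[OF p, of b] face_mono[OF pB(1) \<open>b \<in> B\<close>] sep[OF \<open>b \<noteq> p\<close>] that by auto
    ultimately show ?thesis using lex[of b p] that pB by force
  qed
  have r2: "v \<bullet> r < v \<bullet> b" if "b \<in> B" "b \<noteq> r" for b
  proof -
    have "u \<bullet> r \<le> u \<bullet> b" using faceD[OF pB(2) that(1)] by simp
    moreover have "h \<bullet> r < h \<bullet> b" if "u \<bullet> b = u \<bullet> r"
      using faceD[OF r, of b] face_mono[OF pB(2) \<open>b \<in> B\<close>] sep[OF \<open>b \<noteq> r\<close>] that by auto
    ultimately show ?thesis using lex[of r b] that pB by force
  qed
  have neA: "A \<noteq> {}" using ncA by auto
  obtain ap where ap: "ap \<in> face A v" using face_nonempty finA neA by metis
  obtain am where am: "am \<in> face A (- v)" using face_nonempty finA neA by metis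
  have apm: "ap \<noteq> am" using noncollinear_face_opposite[OF ncA \<open>v \<noteq> 0\<close> ap] am by auto
  have A: "ap \<in> A" "am \<in> A" using ap am face_subset by blast+
  have ap2: "v \<bullet> a < v \<bullet> ap" if "a \<in> A" "a \<noteq> ap" for a
    using faceD[OF ap that(1)] inj[of a ap] that A by force
  have am2: "v \<bullet> am < v \<bullet> a" if "a \<in> A" "a \<noteq> am" for a
    using faceD[OF am that(1)] inj[of a am] that A by force
  show ?thesis
    by (rule antipodal_bound[OF finA finB ncA ncB \<open>v \<noteq> 0\<close> A(1) ap2 A(2) am2 pB(3) p2 pB(4) r2 small nonedge apm pr])
qed

section \<open>Polygons with at least four vertices\<close>

text \<open>Gift wrapping: a supporting line that touches only \<open>p\<close> is turned about
  \<open>p\<close> until it meets a second point.\<close>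

lemma exists_edge:
  assumes fin: "finite B" and nc: "\<not> collinear B" and fr: "\<And>x. x \<in> B \<Longrightarrow> \<exists>u. u \<noteq> 0 \<and> x \<in> face B u"
  obtains u p q where "u \<noteq> 0" "p \<noteq> q" "p \<in> face B u" "q \<in> face B u"
proof -
  have "B \<noteq> {}" using nc by auto
  then obtain p where p: "p \<in> B" by blast
  then obtain u where u: "u \<noteq> 0" "p \<in> face B u" using fr by blast
  show ?thesis
  proof (cases "\<exists>q. q \<noteq> p \<and> q \<in> face B u")
    case True
    then show ?thesis using that u by metis
  next
    case False
    have lt: "u \<bullet> b < u \<bullet> p" if "b \<in> B - {p}" for b
      using faceD[OF u(2), of b] face_mono[OF u(2), of b] False that by force
    \<comment> \<open>\<open>g b\<close> is the \<open>s\<close> for which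
      \<open>s u + perp u\<close> has equal values at \<open>b\<close> and \<open>p\<close>. As the
      line turns away from \<open>u\<close>, \<open>s\<close> decreases, so the largest value is met
      first.\<close>
    define g where "g b = (perp u \<bullet> b - perp u \<bullet> p) / (u \<bullet> p - u \<bullet> b)" for b
    have "B - {p} \<noteq> {}" using nc by (metis Diff_eq_empty_iff collinear_sing collinear_empty subset_singletonD)
    then obtain q where q: "q \<in> B - {p}" "g q = Max (g ` (B - {p}))"
      using Max_in[of "g ` (B - {p})"] fin by fastforce
    then have gq: "g b \<le> g q" if "b \<in> B - {p}" for b using that fin by simp
    define u' where "u' = g q *\<^sub>R u + perp u"
    have "u' \<bullet> b \<le> u' \<bullet> p" if "b \<in> B - {p}" for b
    proof -
      have "perp u \<bullet> b - perp u \<bullet> p \<le> g q * (u \<bullet> p - u \<bullet> b)"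
        using gq[OF that] lt[OF that] by (simp add: g_def pos_divide_le_eq)
      then show ?thesis by (simp add: u'_def inner_add_left algebra_simps)
    qed
    then have pf: "p \<in> face B u'" using p by (auto simp: face_def)
    have "perp u \<bullet> q - perp u \<bullet> p = g q * (u \<bullet> p - u \<bullet> q)"
      using lt[OF q(1)] by (simp add: g_def)
    then have "u' \<bullet> q = u' \<bullet> p" by (simp add: u'_def inner_add_left algebra_simps)
    then have "q \<in> face B u'" using face_mono[OF pf, of q] q by simp
    moreover have "u' \<bullet> perp u \<noteq> 0" using u(1) by (simp add: u'_def inner_add_left)
    then have "u' \<noteq> 0" by auto
    ultimately show ?thesis using that pf q by blast
  qed
qed

text \<open>Take an edge with ends \<open>p\<close>, \<open>q\<close> and the opposite face with
  ends \<open>rL\<close>, \<open>rR\<close>. If the bound failed, \<open>p\<close> and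
  \<open>rR\<close> as well as \<open>q\<close> and \<open>rL\<close> would share a face. For
  \<open>rL \<noteq> rR\<close> these are crossing diagonals, which is impossible. For
  \<open>rL = rR\<close> the hull is a triangle, and with at most two points on each edge
  \<open>B\<close> has only three points.\<close>

lemma good_sums_bound_polygon:
  assumes finA: "finite A" and finB: "finite B" and ncA: "\<not> collinear A" and ncB: "\<not> collinear B"
    and small: "\<And>u. u \<noteq> 0 \<Longrightarrow> card (face B u) \<le> 2"
    and fr: "\<And>x. x \<in> B \<Longrightarrow> \<exists>u. u \<noteq> 0 \<and> x \<in> face B u"
    and four: "card B \<ge> 4"
  shows "card A + card B \<le> 2 * card (good_sums A B) + 6"
proof (rule ccontr)
  assume contr: "\<not> ?thesis"
  obtain u p' q' where u: "u \<noteq> 0" and pq': "p' \<noteq> q'" "p' \<in> face B u" "q' \<in> face B u"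
    using exists_edge[OF finB ncB fr] by blast
  define h where "h = perp u"
  have finf: "finite (face B x)" for x using finB face_subset finite_subset by metis
  obtain p where p: "p \<in> face (face B u) (- h)" using face_nonempty[of "face B u" "- h"] finf pq' by blast
  obtain q where q: "q \<in> face (face B u) h" using face_nonempty[of "face B u" h] finf pq' by blast
  have "B \<noteq> {}" using ncB by auto
  then have ne: "face B (- u) \<noteq> {}" using face_nonempty[of B "- u"] finB by blast
  obtain rR where rR: "rR \<in> face (face B (- u)) h" using face_nonempty ne finf by metis
  obtain rL where rL: "rL \<in> face (face B (- u)) (- h)" using face_nonempty ne finf by metis
  have f: "p \<in> face B u" "q \<in> face B u" "rR \<in> face B (- u)" "rL \<in> face B (- u)"
    using p q rR rL face_subset by blast+
  then have inB: "p \<in> B" "q \<in> B" "rR \<in> B" "rL \<in> B" using face_subset by blast+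
  have "h \<bullet> p' \<noteq> h \<bullet> q'" using eq_if_inner_perp_eq[OF u face_eq[OF pq'(2,3)]] pq'(1) by (auto simp: h_def)
  then have Hpq: "h \<bullet> p < h \<bullet> q"
    using faceD[OF p pq'(2)] faceD[OF p pq'(3)] faceD[OF q pq'(2)] faceD[OF q pq'(3)] by auto
  have Upq: "u \<bullet> p = u \<bullet> q" using f face_eq by blast
  have Ur: "u \<bullet> rL = u \<bullet> rR" using face_eq[OF f(4,3)] by simp
  have Upr: "u \<bullet> rR < u \<bullet> p"
    using noncollinear_face_opposite[OF ncB u f(1)] faceD[OF f(1) inB(3)] face_mono[OF f(3) inB(1)] by force
  obtain u1 where u1: "u1 \<noteq> 0" "p \<in> face B u1" "rR \<in> face B u1"
    using antipodal_bound_lex[OF finA finB ncA ncB small u, of "- h" p rR] p rR contr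
    by (auto simp: h_def)
  obtain u2 where u2: "u2 \<noteq> 0" "q \<in> face B u2" "rL \<in> face B u2"
    using antipodal_bound_lex[OF finA finB ncA ncB small u, of h q rL] q rL contr
    by (auto simp: h_def)
  have zero: "z = 0" if "z \<bullet> p = z \<bullet> q" "z \<bullet> p = z \<bullet> rR" for z
  proof -
    obtain \<alpha> \<beta> where z: "z = \<alpha> *\<^sub>R u + \<beta> *\<^sub>R h" using perp_basis[OF u] h_def by metis
    have "\<beta> * (h \<bullet> q - h \<bullet> p) = 0" using that(1) Upq by (auto simp: z inner_add_left algebra_simps)
    then have \<beta>: "\<beta> = 0" using Hpq by simp
    have "\<alpha> * (u \<bullet> p - u \<bullet> rR) = 0" using that(2) \<beta> by (simp add: z inner_add_left algebra_simps)
    then show ?thesis using \<beta> Upr z by simp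
  qed
  show False
  proof (cases "rL = rR")
    case False
    then have "h \<bullet> rL \<noteq> h \<bullet> rR" using eq_if_inner_perp_eq[OF u Ur] by (auto simp: h_def)
    then have Hr: "h \<bullet> rL < h \<bullet> rR" using faceD[OF rR f(4)] by simp
    obtain \<alpha> \<beta> where z: "u1 = \<alpha> *\<^sub>R u + \<beta> *\<^sub>R h" using perp_basis[OF u] h_def by metis
    \<comment> \<open>Along \<open>h\<close>, \<open>q\<close> lies beyond \<open>p\<close> but
      \<open>rL\<close> before \<open>rR\<close>, so a nonzero \<open>h\<close>-component of
      \<open>u1\<close> would prefer \<open>q\<close> to \<open>p\<close> or \<open>rL\<close> to
      \<open>rR\<close>.\<close>
    have "\<beta> * (h \<bullet> q) \<le> \<beta> * (h \<bullet> p)" using faceD[OF u1(2) inB(2)] Upq by (simp add: z inner_add_left)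
    moreover have "\<beta> * (h \<bullet> rL) \<le> \<beta> * (h \<bullet> rR)" using faceD[OF u1(3) inB(4)] Ur by (simp add: z inner_add_left)
    ultimately have "\<beta> = 0" using Hr Hpq by (smt (verit) mult_le_cancel_left)
    then have "u1 \<bullet> p = u1 \<bullet> q" using Upq by (simp add: z)
    then show False using zero[of u1] u1 face_eq by blast
  next
    case True
    define r where "r = rR"
    have "b \<in> {p, q, r}" if b: "b \<in> B" for b
    proof (rule ccontr)
      assume bn: "b \<notin> {p, q, r}"
      \<comment> \<open>\<open>x\<close>, \<open>y\<close>, \<open>z\<close> are the barycentric
        coordinates of \<open>b\<close> with respect to \<open>p\<close>, \<open>q\<close>,
        \<open>r\<close>. They are nonnegative because all three sides are edges of the hull, with
        normals \<open>u\<close>, \<open>u1\<close>, \<open>u2\<close>.\<close>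
      define z where "z = (u \<bullet> p - u \<bullet> b) / (u \<bullet> p - u \<bullet> r)"
      define y where "y = (h \<bullet> b - h \<bullet> p - z * (h \<bullet> r - h \<bullet> p)) / (h \<bullet> q - h \<bullet> p)"
      define x where "x = 1 - y - z"
      have z1: "z * (u \<bullet> p - u \<bullet> r) = u \<bullet> p - u \<bullet> b" using Upr by (simp add: z_def r_def)
      have y1: "y * (h \<bullet> q - h \<bullet> p) = h \<bullet> b - h \<bullet> p - z * (h \<bullet> r - h \<bullet> p)" using Hpq by (simp add: y_def)
      have "b = x *\<^sub>R p + y *\<^sub>R q + z *\<^sub>R r"
      proof (rule eq_if_inner_perp_eq[OF u])
        show "u \<bullet> b = u \<bullet> (x *\<^sub>R p + y *\<^sub>R q + z *\<^sub>R r)"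
          using z1 Upq by (simp add: x_def inner_add_right algebra_simps)
        show "perp u \<bullet> b = perp u \<bullet> (x *\<^sub>R p + y *\<^sub>R q + z *\<^sub>R r)"
          using y1 unfolding h_def by (simp add: x_def inner_add_right algebra_simps)
      qed
      then have comb: "w \<bullet> b = x * (w \<bullet> p) + y * (w \<bullet> q) + z * (w \<bullet> r)" for w
        by (simp add: inner_add_right)
      have bar: "x * (w \<bullet> p - w \<bullet> b) + y * (w \<bullet> q - w \<bullet> b) + z * (w \<bullet> r - w \<bullet> b) = 0" for w
      proof -
        have "x * (w \<bullet> p - w \<bullet> b) + y * (w \<bullet> q - w \<bullet> b) + z * (w \<bullet> r - w \<bullet> b) = w \<bullet> b - (x + y + z) * (w \<bullet> b)"
          using comb[of w] by (simp add: algebra_simps)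
        then show ?thesis by (simp add: x_def)
      qed
      have z0: "0 \<le> z" unfolding z_def using faceD[OF f(1) b] Upr by (simp add: r_def)
      have y0: "0 \<le> y"
      proof -
        have e: "u1 \<bullet> p = u1 \<bullet> r" using u1 face_eq r_def by blast
        have "u1 \<bullet> q < u1 \<bullet> p" using faceD[OF u1(2) inB(2)] zero[of u1] u1(1) e by (force simp: r_def)
        moreover have "u1 \<bullet> b = u1 \<bullet> p - y * (u1 \<bullet> p - u1 \<bullet> q)"
          using comb[of u1] by (simp add: e x_def algebra_simps)
        moreover have "u1 \<bullet> b \<le> u1 \<bullet> p" using faceD[OF u1(2) b] .
        ultimately show ?thesis by (simp add: zero_le_mult_iff)
      qed
      have x0: "0 \<le> x"
      proof -
        have e: "u2 \<bullet> q = u2 \<bullet> r" using u2 face_eq r_def True by blast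
        have "u2 \<bullet> p < u2 \<bullet> q" using faceD[OF u2(2) inB(1)] zero[of u2] u2(1) e by (force simp: r_def)
        moreover have "u2 \<bullet> b = u2 \<bullet> q - x * (u2 \<bullet> q - u2 \<bullet> p)"
          using comb[of u2] by (simp add: e x_def algebra_simps)
        moreover have "u2 \<bullet> b \<le> u2 \<bullet> q" using faceD[OF u2(2) b] .
        ultimately show ?thesis by (simp add: zero_le_mult_iff)
      qed
      obtain w where w: "w \<noteq> 0" "b \<in> face B w" using fr[OF b] by blast
      have le: "w \<bullet> p \<le> w \<bullet> b" "w \<bullet> q \<le> w \<bullet> b" "w \<bullet> r \<le> w \<bullet> b"
        using faceD[OF w(2)] inB by (auto simp: r_def)
      \<comment> \<open>The weighted slacks at \<open>b\<close> are nonpositive and add up to 0, so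
        each vertex of nonzero weight lies on the face of \<open>b\<close>. Two such vertices and
        \<open>b\<close> would be three points on an edge.\<close>
      have t: "x * (w \<bullet> p - w \<bullet> b) \<le> 0" "y * (w \<bullet> q - w \<bullet> b) \<le> 0" "z * (w \<bullet> r - w \<bullet> b) \<le> 0"
        using x0 y0 z0 le by (auto simp: mult_le_0_iff)
      then have "x * (w \<bullet> p - w \<bullet> b) = 0" "y * (w \<bullet> q - w \<bullet> b) = 0" "z * (w \<bullet> r - w \<bullet> b) = 0"
        using bar[of w] by linarith+
      then have pos: "x = 0 \<or> p \<in> face B w" "y = 0 \<or> q \<in> face B w" "z = 0 \<or> r \<in> face B w"
        using face_mono[OF w(2)] inB by (auto simp: r_def)
      have two: "\<not> (s \<in> face B w \<and> t \<in> face B w)" if "s \<noteq> t" "s \<noteq> b" "t \<noteq> b" for s t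
      proof
        assume "s \<in> face B w \<and> t \<in> face B w"
        then have "card {s, t, b} \<le> card (face B w)" using w by (intro card_mono finf) auto
        then show False using small[OF w(1)] that by simp
      qed
      have pqr: "p \<noteq> q" "p \<noteq> r" "q \<noteq> r" using Hpq Upr Upq by (auto simp: r_def)
      have "x + y + z = 1" by (simp add: x_def)
      then consider "x \<noteq> 0" "y \<noteq> 0" | "x \<noteq> 0" "z \<noteq> 0" | "y \<noteq> 0" "z \<noteq> 0"
        | "x = 1" "y = 0" "z = 0" | "x = 0" "y = 1" "z = 0" | "x = 0" "y = 0" "z = 1" by argo
      then show False
        using pos two[of p q] two[of p r] two[of q r] bn pqr \<open>b = x *\<^sub>R p + y *\<^sub>R q + z *\<^sub>R r\<close>
        by cases auto
    qed
    then have "card B \<le> card {p, q, r}" by (intro card_mono) auto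
    also have "\<dots> \<le> 3" by (simp add: card_insert_if)
    finally show False using four by simp
  qed
qed

section \<open>Sums with a triangle\<close>

text \<open>A point in exactly \<open>m\<close> of the sets satisfies
  \<open>m + [m = 1] = 2 + [m = 3]\<close> for \<open>m = 1, 2, 3\<close>; \<open>E\<close> consists
  of the points with \<open>m = 1\<close>.\<close>

lemma card_three_sets:
  assumes "finite X" "finite Y" "finite Z"
  defines "U \<equiv> X \<union> Y \<union> Z"
  defines "E \<equiv> {x \<in> U. (x \<in> X \<longrightarrow> x \<notin> Y \<and> x \<notin> Z) \<and> (x \<in> Y \<longrightarrow> x \<notin> Z)}"
  shows "card X + card Y + card Z + card E = 2 * card U + card (X \<inter> Y \<inter> Z)"
proof -
  have fin: "finite U" using assms by simp
  have ind: "card S = (\<Sum>x\<in>U. of_bool (x \<in> S))" if "S \<subseteq> U" for S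
    using that fin by (simp add: Int_absorb1)
  have "card X + card Y + card Z + card E =
      (\<Sum>x\<in>U. of_bool (x \<in> X) + of_bool (x \<in> Y) + of_bool (x \<in> Z) + of_bool (x \<in> E))"
    unfolding sum.distrib by (subst (1 2 3 4) ind) (auto simp: U_def E_def)
  also have "\<dots> = (\<Sum>x\<in>U. 2 + of_bool (x \<in> X \<inter> Y \<inter> Z))"
    by (intro sum.cong refl) (auto simp: E_def U_def)
  also have "\<dots> = 2 * card U + card (X \<inter> Y \<inter> Z)"
    unfolding sum.distrib by (subst (2) ind) (auto simp: U_def)
  finally show ?thesis .
qed

text \<open>\<open>w1\<close>, \<open>w2\<close>, \<open>w3\<close> are the gradients of the barycentric coordinates with respect to \<open>b1\<close>, \<open>b2\<close>, \<open>b3\<close>,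
  i.e. inner edge normals of the triangle.\<close>
locale triangle_summand =
  fixes A B :: "(real^2) set" and b1 b2 b3 w1 w2 w3 :: "real^2"
  assumes B_eq: "B = {b1, b2, b3}"
    and ws: "w1 + w2 + w3 = 0"
    and dual: "w1 \<bullet> b1 = w1 \<bullet> b2 + 1" "w1 \<bullet> b3 = w1 \<bullet> b2"
      "w2 \<bullet> b2 = w2 \<bullet> b3 + 1" "w2 \<bullet> b1 = w2 \<bullet> b3"
      "w3 \<bullet> b3 = w3 \<bullet> b1 + 1" "w3 \<bullet> b2 = w3 \<bullet> b1"
    and rep: "\<And>u. u = (u \<bullet> b1) *\<^sub>R w1 + (u \<bullet> b2) *\<^sub>R w2 + (u \<bullet> b3) *\<^sub>R w3"
    and finA: "finite A" and ncA: "\<not> collinear A"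
    and fr: "\<And>x. x \<in> A \<Longrightarrow> \<exists>u. u \<noteq> 0 \<and> x \<in> face A u"
begin

text \<open>The hypotheses are cyclically symmetric; the interpretations \<open>r\<close> and
  \<open>rr\<close> below transfer facts about one vertex to the other two.\<close>

lemma rotate: "triangle_summand A B b2 b3 b1 w2 w3 w1"
proof
  show "B = {b2, b3, b1}" using B_eq by auto
  show "w2 + w3 + w1 = 0" using ws by (simp add: algebra_simps)
  show "u = (u \<bullet> b2) *\<^sub>R w2 + (u \<bullet> b3) *\<^sub>R w3 + (u \<bullet> b1) *\<^sub>R w1" for u
    using rep[of u] by (simp add: algebra_simps)
qed (use dual finA ncA fr in auto)

lemma w3_eq: "w3 = - w1 - w2"
  using ws by (metis add.commute eq_neg_iff_add_eq_0 minus_add_distrib uminus_add_conv_diff diff_conv_add_uminus)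

lemma dual_eqI:
  assumes "w1 \<bullet> x = w1 \<bullet> y" "w2 \<bullet> x = w2 \<bullet> y"
  shows "x = y"
proof -
  have "(x - y) \<bullet> (x - y) = (((x - y) \<bullet> b1) *\<^sub>R w1 + ((x - y) \<bullet> b2) *\<^sub>R w2 + ((x - y) \<bullet> b3) *\<^sub>R w3) \<bullet> (x - y)"
    using rep[of "x - y"] by simp
  also have "\<dots> = 0" using assms by (simp add: w3_eq inner_add_left inner_diff_left inner_diff_right)
  finally show ?thesis by simp
qed

section \<open>Normal cones at the vertices of the triangle\<close>

text \<open>The outer normals at \<open>b1\<close> form the cone of \<open>- w2\<close> and
  \<open>- w3\<close>, the outer normals of the edges through \<open>b1\<close>; the coefficients
  are the drops of \<open>u\<close> from \<open>b1\<close> to \<open>b2\<close> and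
  \<open>b3\<close>.\<close>

lemma common_normal_b1E:
  assumes "common_normal A B a b1"
  obtains t2 t3 where "0 \<le> t2" "0 \<le> t3" "t2 \<noteq> 0 \<or> t3 \<noteq> 0" "a \<in> face A (- (t2 *\<^sub>R w2 + t3 *\<^sub>R w3))"
proof -
  obtain u where u: "u \<noteq> 0" "a \<in> face A u" "b1 \<in> face B u" using assms by (auto simp: common_normal_def)
  define t2 t3 where "t2 = u \<bullet> b1 - u \<bullet> b2" and "t3 = u \<bullet> b1 - u \<bullet> b3"
  have ut: "u = - (t2 *\<^sub>R w2 + t3 *\<^sub>R w3)"
    by (subst rep[of u]) (simp add: w3_eq t2_def t3_def algebra_simps)
  have "0 \<le> t2" "0 \<le> t3" using faceD[OF u(3)] by (auto simp: B_eq t2_def t3_def)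
  moreover have "t2 \<noteq> 0 \<or> t3 \<noteq> 0" using u(1) ut by auto
  ultimately show ?thesis using that u(2) ut by simp
qed

lemma face_w1_common_normal:
  assumes "a \<in> face A (- w1)"
  shows "common_normal A B a b2" "common_normal A B a b3"
proof -
  have "w1 \<noteq> 0" using dual(1) by auto
  moreover have "b2 \<in> face B (- w1)" "b3 \<in> face B (- w1)" using dual by (auto simp: face_def B_eq)
  ultimately show "common_normal A B a b2" "common_normal A B a b3" using assms unfolding common_normal_def by (metis neg_equal_0_iff_equal)+
qed

text \<open>The normals of \<open>a\<close> form a convex cone that meets the normal cones of
  \<open>b1\<close> and \<open>b2\<close>. It contains their shared ray \<open>- w3\<close>, or it
  passes the other way round and contains both other edge normals.\<close>

lemma common_normal_b1_b2_cases:
  assumes "common_normal A B a b1" "common_normal A B a b2"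
  shows "a \<in> face A (- w3) \<or> a \<in> face A (- w1) \<and> a \<in> face A (- w2)"
proof -
  interpret r: triangle_summand A B b2 b3 b1 w2 w3 w1 by (rule rotate)
  obtain t2 t3 where t: "0 \<le> t2" "0 \<le> t3" "t2 \<noteq> 0 \<or> t3 \<noteq> 0" "a \<in> face A (- (t2 *\<^sub>R w2 + t3 *\<^sub>R w3))"
    by (rule common_normal_b1E[OF assms(1)])
  obtain s3 s1 where s: "0 \<le> s3" "0 \<le> s1" "s3 \<noteq> 0 \<or> s1 \<noteq> 0" "a \<in> face A (- (s3 *\<^sub>R w3 + s1 *\<^sub>R w1))"
    by (rule r.common_normal_b1E[OF assms(2)])
  have scale: "a \<in> face A (- w)" if "a \<in> face A z" "z = - (c *\<^sub>R w)" "0 < c" for z c w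
    using that face_scale[of c A "- w"] by simp
  show ?thesis
  proof (cases "t2 = 0 \<or> s1 = 0")
    case True
    then show ?thesis using scale[OF t(4), of t3 w3] scale[OF s(4), of s3 w3] t s by force
  next
    case False
    then have pos: "0 < t2" "0 < s1" using t s by auto
    define u u' where "u = - (t2 *\<^sub>R w2 + t3 *\<^sub>R w3)" and "u' = - (s3 *\<^sub>R w3 + s1 *\<^sub>R w1)"
    have fu: "a \<in> face A u" "a \<in> face A u'" using t s by (auto simp: u_def u'_def)
    \<comment> \<open>The weights \<open>s1\<close> and \<open>t2\<close> balance the
      \<open>w1\<close>- and \<open>w2\<close>-parts, leaving a multiple of \<open>w3\<close>. The
      sign of \<open>c\<close> tells which way round the cone passes; \<open>c = 0\<close> means
      opposite normals.\<close>
    define c where "c = s1 * t3 + t2 * s3 - s1 * t2"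
    have c1: "s1 *\<^sub>R u + t2 *\<^sub>R u' = - (c *\<^sub>R w3)"
      by (simp add: u_def u'_def c_def w3_eq algebra_simps)
    consider "c > 0" | "c = 0" | "c < 0" by linarith
    then show ?thesis
    proof cases
      case 1
      have "a \<in> face A (s1 *\<^sub>R u + t2 *\<^sub>R u')" using face_cone[OF fu] pos by simp
      then show ?thesis using scale c1 1 by blast
    next
      case 2
      have "w3 \<bullet> (b1 - b2) = 0" "w2 \<bullet> (b1 - b2) = -1"
        using dual by (auto simp: inner_diff_right)
      then have "u \<bullet> (b1 - b2) = t2" by (simp add: u_def inner_diff_left)
      then have nz: "u \<noteq> 0" using pos by auto
      have "t2 *\<^sub>R u' = s1 *\<^sub>R (- u)" using c1 2 by (simp add: eq_neg_iff_add_eq_0 add.commute)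
      then have "a \<in> face A (- u)" using fu(2) face_scale pos by metis
      then show ?thesis using noncollinear_face_opposite[OF ncA nz fu(1)] by simp
    next
      case 3
      \<comment> \<open>Now \<open>- w1\<close> and \<open>- w2\<close> are themselves in the cone of \<open>u\<close> and \<open>u'\<close>.\<close>
      have "0 \<le> s1 * t3" "0 \<le> t2 * s3" using t s by auto
      then have "s1 * t3 \<le> s1 * t2" "t2 * s3 \<le> t2 * s1"
        using 3 unfolding c_def by (simp_all add: mult.commute)
      then have le: "0 \<le> t2 - t3" "0 \<le> s1 - s3" using pos by auto
      have "s3 *\<^sub>R u + (t2 - t3) *\<^sub>R u' = - ((- c) *\<^sub>R w1)"
        "(s1 - s3) *\<^sub>R u + t3 *\<^sub>R u' = - ((- c) *\<^sub>R w2)"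
        by (simp_all add: u_def u'_def c_def w3_eq algebra_simps)
      moreover have "a \<in> face A (s3 *\<^sub>R u + (t2 - t3) *\<^sub>R u')" "a \<in> face A ((s1 - s3) *\<^sub>R u + t3 *\<^sub>R u')"
        using face_cone[OF fu] le t s by auto
      ultimately show ?thesis using scale 3 by (metis neg_0_less_iff_less)
    qed
  qed
qed

section \<open>Points hit by three selected sums\<close>

text \<open>The selection rule pairs \<open>a\<close> with \<open>b1\<close> if \<open>a\<close>
  shares a normal with \<open>b3\<close> but not with \<open>b1\<close>, and so on cyclically. At a
  triple the selected sums with all three vertices coincide.\<close>

definition triple :: "real^2 \<Rightarrow> bool" where
  "triple s \<longleftrightarrow> s - b1 \<in> A \<and> \<not> common_normal A B (s - b1) b1 \<and> common_normal A B (s - b1) b3 \<and>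
    s - b2 \<in> A \<and> \<not> common_normal A B (s - b2) b2 \<and> common_normal A B (s - b2) b1 \<and>
    s - b3 \<in> A \<and> \<not> common_normal A B (s - b3) b3 \<and> common_normal A B (s - b3) b2"

text \<open>A normal shared by \<open>s - b2\<close> and \<open>b1\<close> cannot increase along
  \<open>b1 - b2\<close>, because the second triple puts the shifted point into \<open>A\<close>.
  This leaves only the direction \<open>- w3\<close>, which is also normal at \<open>b2\<close>,
  against the first triple.\<close>

lemma no_parallel_triples:
  assumes "triple s" "triple (s + \<tau> *\<^sub>R (b1 - b2))" "0 < \<tau>"
  shows False
proof -
  interpret r: triangle_summand A B b2 b3 b1 w2 w3 w1 by (rule rotate)
  interpret rr: triangle_summand A B b3 b1 b2 w3 w1 w2 by (rule r.rotate)
  have b: "common_normal A B (s - b2) b1" "\<not> common_normal A B (s - b2) b2" "s + \<tau> *\<^sub>R (b1 - b2) - b2 \<in> A"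
    using assms by (auto simp: triple_def)
  obtain t2 t3 where t: "0 \<le> t2" "0 \<le> t3" "t2 \<noteq> 0 \<or> t3 \<noteq> 0" "s - b2 \<in> face A (- (t2 *\<^sub>R w2 + t3 *\<^sub>R w3))"
    by (rule common_normal_b1E[OF b(1)])
  define u where "u = - (t2 *\<^sub>R w2 + t3 *\<^sub>R w3)"
  have "u \<bullet> (\<tau> *\<^sub>R (b1 - b2)) \<le> 0"
    using faceD[OF t(4)[folded u_def] b(3)] by (simp add: inner_add_right inner_diff_right algebra_simps)
  moreover have "u \<bullet> (b1 - b2) = t2" using dual by (simp add: u_def inner_add_left inner_diff_right algebra_simps)
  ultimately have "t2 = 0" using t(1) assms(3) by (simp add: mult_le_0_iff)
  then have "s - b2 \<in> face A (- w3)" using t face_scale[of t3 A "- w3"] by simp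
  then show False using rr.face_w1_common_normal b(2) by blast
qed

text \<open>A normal shared by \<open>s - b3\<close> and \<open>b2\<close> is tested on two points
  of \<open>A\<close>: \<open>s - b1\<close> yields \<open>t1 \<le> t3\<close>, and
  \<open>s' - b3\<close> yields \<open>t3 * (x + y) \<le> t1 * x\<close>. For positive
  \<open>x\<close> and \<open>y\<close> both coefficients vanish.\<close>

lemma no_general_triples:
  assumes "triple s" "triple s'" "0 < w1 \<bullet> (s' - s)" "0 < w2 \<bullet> (s' - s)"
  shows False
proof -
  interpret r: triangle_summand A B b2 b3 b1 w2 w3 w1 by (rule rotate)
  have b: "common_normal A B (s - b3) b2" "s' - b3 \<in> A" "s - b1 \<in> A"
    using assms by (auto simp: triple_def)
  define x y where "x = w1 \<bullet> (s' - s)" and "y = w2 \<bullet> (s' - s)"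
  obtain t3 t1 where t: "0 \<le> t3" "0 \<le> t1" "t3 \<noteq> 0 \<or> t1 \<noteq> 0" "s - b3 \<in> face A (- (t3 *\<^sub>R w3 + t1 *\<^sub>R w1))"
    by (rule r.common_normal_b1E[OF b(1)])
  define u where "u = - (t3 *\<^sub>R w3 + t1 *\<^sub>R w1)"
  note fu = t(4)[folded u_def]
  have "u \<bullet> (b3 - b1) \<le> 0"
    using faceD[OF fu b(3)] by (simp add: inner_diff_right)
  moreover have "u \<bullet> (b3 - b1) = t1 - t3"
    using dual by (simp add: u_def inner_add_left inner_diff_right algebra_simps)
  ultimately have 1: "t1 \<le> t3" by simp
  have "u \<bullet> (s' - s) \<le> 0"
    using faceD[OF fu b(2)] by (simp add: inner_diff_right)
  moreover have "u \<bullet> (s' - s) = t3 * (x + y) - t1 * x"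
    by (simp add: u_def w3_eq inner_add_left inner_diff_left x_def y_def algebra_simps)
  ultimately have "t3 * (x + y) \<le> t1 * x" by simp
  also have "t1 * x \<le> t3 * x" using 1 assms(3) by (simp add: x_def)
  finally have "t3 * y \<le> 0" by (simp add: algebra_simps)
  then have "t3 = 0" using t(1) assms(4) by (simp add: y_def mult_le_0_iff)
  then show False using 1 t by simp
qed

lemma parallel_triples_eq:
  assumes "triple s" "triple s'" "w3 \<bullet> (s' - s) = 0"
  shows "s = s'"
proof -
  define x where "x = w1 \<bullet> (s' - s)"
  have eq: "s' = s + x *\<^sub>R (b1 - b2)"
  proof (rule dual_eqI)
    show "w1 \<bullet> s' = w1 \<bullet> (s + x *\<^sub>R (b1 - b2))"
      using dual by (simp add: x_def inner_add_right inner_diff_right)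
    have "w2 \<bullet> (s' - s) = - x" using assms(3) by (simp add: w3_eq x_def inner_add_left inner_diff_left)
    then show "w2 \<bullet> s' = w2 \<bullet> (s + x *\<^sub>R (b1 - b2))"
      using dual by (simp add: inner_add_right inner_diff_right)
  qed
  consider "x > 0" | "x = 0" | "x < 0" by linarith
  then show ?thesis
  proof cases
    case 1
    then show ?thesis using no_parallel_triples[of s x] assms eq by simp
  next
    case 2
    then show ?thesis using eq by simp
  next
    case 3
    have "s = s' + (- x) *\<^sub>R (b1 - b2)" using eq by simp
    then show ?thesis using no_parallel_triples[of s' "- x"] assms 3 by simp
  qed
qed

lemma triple_unique:
  assumes "triple s" "triple s'"
  shows "s = s'"
proof -
  interpret r: triangle_summand A B b2 b3 b1 w2 w3 w1 by (rule rotate)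
  interpret rr: triangle_summand A B b3 b1 b2 w3 w1 w2 by (rule r.rotate)
  have tr: "r.triple s" "r.triple s'" "rr.triple s" "rr.triple s'"
    using assms by (auto simp: triple_def r.triple_def rr.triple_def)
  have w3: "w3 \<bullet> t = - (w1 \<bullet> t + w2 \<bullet> t)" for t
    using arg_cong[OF ws, of "\<lambda>x. x \<bullet> t"] by (simp add: inner_add_left)
  have swap: "w \<bullet> (s - s') = - (w \<bullet> (s' - s))" for w by (simp add: inner_diff_right)
  \<comment> \<open>The three \<open>w\<close>-values of \<open>s' - s\<close> add up to 0: either
    one vanishes, or two have the same sign, positive after exchanging \<open>s\<close> and
    \<open>s'\<close> if necessary.\<close>
  consider "w1 \<bullet> (s' - s) = 0" | "w2 \<bullet> (s' - s) = 0" | "w3 \<bullet> (s' - s) = 0"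
    | "0 < w1 \<bullet> (s' - s)" "0 < w2 \<bullet> (s' - s)" | "0 < w2 \<bullet> (s' - s)" "0 < w3 \<bullet> (s' - s)"
    | "0 < w3 \<bullet> (s' - s)" "0 < w1 \<bullet> (s' - s)"
    | "0 < w1 \<bullet> (s - s')" "0 < w2 \<bullet> (s - s')" | "0 < w2 \<bullet> (s - s')" "0 < w3 \<bullet> (s - s')"
    | "0 < w3 \<bullet> (s - s')" "0 < w1 \<bullet> (s - s')"
    unfolding swap using w3[of "s' - s"] by linarith
  then show ?thesis
  proof cases
    case 1 then show ?thesis by (rule r.parallel_triples_eq[OF tr(1,2)])
  next
    case 2 then show ?thesis by (rule rr.parallel_triples_eq[OF tr(3,4)])
  next
    case 3 then show ?thesis by (rule parallel_triples_eq[OF assms])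
  next
    case 4 then show ?thesis using no_general_triples assms by blast
  next
    case 5 then show ?thesis using r.no_general_triples tr by blast
  next
    case 6 then show ?thesis using rr.no_general_triples tr by blast
  next
    case 7 then show ?thesis using no_general_triples assms by blast
  next
    case 8 then show ?thesis using r.no_general_triples tr by blast
  next
    case 9 then show ?thesis using rr.no_general_triples tr by blast
  qed
qed

lemma common_normal_some:
  assumes "a \<in> A"
  shows "common_normal A B a b1 \<or> common_normal A B a b2 \<or> common_normal A B a b3"
proof -
  obtain u where u: "u \<noteq> 0" "a \<in> face A u" using fr assms by blast
  obtain b where "b \<in> face B u" using face_nonempty[of B u] B_eq by auto
  then show ?thesis using u face_subset[of B u] B_eq unfolding common_normal_def by blast
qed

lemma corner_card_le: "card (face A (- w1) \<inter> face A (- w2)) \<le> 1"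
proof -
  have "x = y" if "x \<in> face A (- w1) \<inter> face A (- w2)" "y \<in> face A (- w1) \<inter> face A (- w2)" for x y
    using that face_eq[of x A "- w1" y] face_eq[of x A "- w2" y] dual_eqI by auto
  moreover have "finite (face A (- w1) \<inter> face A (- w2))"
    using finA face_subset finite_subset by blast
  ultimately show ?thesis by (metis One_nat_def card_le_Suc0_iff_eq)
qed

text \<open>At the corner \<open>c\<close> both \<open>w2\<close> and \<open>w3\<close> are minimal
  on \<open>A\<close>. A nonnegative combination that is minimal at \<open>a\<close> forces
  \<open>a\<close> to agree with \<open>c\<close> wherever the weight is positive.\<close>

lemma common_normal_b1_face:
  assumes "a \<in> A" "common_normal A B a b1" "c \<in> face A (- w2)" "c \<in> face A (- w3)"
  shows "a \<in> face A (- w2) \<or> a \<in> face A (- w3)"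
proof -
  obtain t2 t3 where t: "0 \<le> t2" "0 \<le> t3" "t2 \<noteq> 0 \<or> t3 \<noteq> 0" "a \<in> face A (- (t2 *\<^sub>R w2 + t3 *\<^sub>R w3))"
    by (rule common_normal_b1E[OF assms(2)])
  have cA: "c \<in> A" using assms(3) face_subset by blast
  have le: "w2 \<bullet> c \<le> w2 \<bullet> a" "w3 \<bullet> c \<le> w3 \<bullet> a" using faceD[OF assms(3,1)] faceD[OF assms(4,1)] by auto
  have "t2 * (w2 \<bullet> a) + t3 * (w3 \<bullet> a) \<le> t2 * (w2 \<bullet> c) + t3 * (w3 \<bullet> c)"
    using faceD[OF t(4) cA] by (simp add: inner_diff_left)
  then have "t2 * (w2 \<bullet> a - w2 \<bullet> c) + t3 * (w3 \<bullet> a - w3 \<bullet> c) \<le> 0" by (simp add: algebra_simps)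
  moreover have "0 \<le> t2 * (w2 \<bullet> a - w2 \<bullet> c)" "0 \<le> t3 * (w3 \<bullet> a - w3 \<bullet> c)" using le t by auto
  ultimately have "t2 * (w2 \<bullet> a - w2 \<bullet> c) = 0" "t3 * (w3 \<bullet> a - w3 \<bullet> c) = 0" by linarith+
  then have "w2 \<bullet> a = w2 \<bullet> c \<or> w3 \<bullet> a = w3 \<bullet> c" using t(3) by auto
  then show ?thesis using face_mono[OF assms(3,1)] face_mono[OF assms(4,1)] by auto
qed

text \<open>Each point of \<open>A\<close> is summed with at most one vertex of \<open>B\<close>; the cyclic selection rule
  makes three coinciding sums occur at most once.\<close>
lemma good_sums_bound_triangle:
  assumes big: "card A > 2 * card (good_sums A B) + 3"
  shows "\<exists>t. A = (\<lambda>y. t + y) ` (B + B)"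
proof -
  interpret r: triangle_summand A B b2 b3 b1 w2 w3 w1 by (rule rotate)
  interpret rr: triangle_summand A B b3 b1 b2 w3 w1 w2 by (rule r.rotate)
  define P1 P2 P3 X where
    "P1 = {a \<in> A. \<not> common_normal A B a b1 \<and> common_normal A B a b3}" and
    "P2 = {a \<in> A. \<not> common_normal A B a b2 \<and> common_normal A B a b1}" and
    "P3 = {a \<in> A. \<not> common_normal A B a b3 \<and> common_normal A B a b2}" and
    "X = {a \<in> A. common_normal A B a b1 \<and> common_normal A B a b2 \<and> common_normal A B a b3}"
  note P_defs = P1_def P2_def P3_def
  have fin: "finite P1" "finite P2" "finite P3" "finite X" using finA by (auto simp: P_defs X_def)
  \<comment> \<open>Around the cycle \<open>b1\<close>, \<open>b2\<close>, \<open>b3\<close>, a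
    pattern of common normals that is neither empty nor full changes from yes to no exactly once, so
    the four sets partition \<open>A\<close>.\<close>
  have A_eq: "A = P1 \<union> (P2 \<union> (P3 \<union> X))" using common_normal_some by (auto simp: P_defs X_def)
  have cA: "card A = card P1 + (card P2 + (card P3 + card X))"
    by (subst A_eq, subst card_Un_disjoint; (subst card_Un_disjoint)?; (subst card_Un_disjoint)?)
      (auto simp: fin, auto simp: P_defs X_def)
  define F1 F2 F3 where "F1 = face A (- w1)" and "F2 = face A (- w2)" and "F3 = face A (- w3)"
  have finF: "finite F1" "finite F2" "finite F3"
    using finA face_subset finite_subset unfolding F1_def F2_def F3_def by metis+
  have corners: "card (F1 \<inter> F2) \<le> 1" "card (F2 \<inter> F3) \<le> 1" "card (F3 \<inter> F1) \<le> 1"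
    using corner_card_le r.corner_card_le rr.corner_card_le by (auto simp: F1_def F2_def F3_def)
  have XF: "X \<subseteq> (F1 \<inter> F2) \<union> ((F2 \<inter> F3) \<union> (F3 \<inter> F1))"
    using common_normal_b1_b2_cases r.common_normal_b1_b2_cases rr.common_normal_b1_b2_cases
    unfolding X_def F1_def F2_def F3_def by blast
  then have "card X \<le> card ((F1 \<inter> F2) \<union> ((F2 \<inter> F3) \<union> (F3 \<inter> F1)))"
    using finF by (intro card_mono) auto
  also have "\<dots> \<le> card (F1 \<inter> F2) + (card (F2 \<inter> F3) + card (F3 \<inter> F1))"
    by (intro order_trans[OF card_Un_le] add_mono order_refl)
  finally have cX: "card X \<le> card (F1 \<inter> F2) + (card (F2 \<inter> F3) + card (F3 \<inter> F1))" .

  define S1 S2 S3 where "S1 = (\<lambda>a. a + b1) ` P1" and "S2 = (\<lambda>a. a + b2) ` P2" and "S3 = (\<lambda>a. a + b3) ` P3"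
  have cS: "card S1 = card P1" "card S2 = card P2" "card S3 = card P3"
    unfolding S1_def S2_def S3_def by (auto intro!: card_image simp: inj_on_def)
  have finS: "finite S1" "finite S2" "finite S3" using fin by (auto simp: S1_def S2_def S3_def)
  have S_iff: "s \<in> S1 \<longleftrightarrow> s - b1 \<in> P1" "s \<in> S2 \<longleftrightarrow> s - b2 \<in> P2" "s \<in> S3 \<longleftrightarrow> s - b3 \<in> P3" for s
    unfolding S1_def S2_def S3_def by (auto simp: image_iff)
       (metis diff_add_cancel)+
  have triple: "triple s" if "s \<in> S1 \<inter> S2 \<inter> S3" for s
    using that by (auto simp: S_iff triple_def P_defs)
  have cI: "card (S1 \<inter> S2 \<inter> S3) \<le> 1"
  proof -
    have "\<forall>x\<in>S1 \<inter> S2 \<inter> S3. \<forall>y\<in>S1 \<inter> S2 \<inter> S3. x = y"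
      using triple triple_unique by blast
    moreover have "finite (S1 \<inter> S2 \<inter> S3)" using finS by auto
    ultimately show ?thesis by (metis One_nat_def card_le_Suc0_iff_eq)
  qed
  define E where "E = {x \<in> S1 \<union> S2 \<union> S3. (x \<in> S1 \<longrightarrow> x \<notin> S2 \<and> x \<notin> S3) \<and> (x \<in> S2 \<longrightarrow> x \<notin> S3)}"
  have "S1 \<union> S2 \<union> S3 \<subseteq> good_sums A B"
    by (auto simp: S1_def S2_def S3_def P_defs B_eq intro!: good_sumsI)
  then have cU: "card (S1 \<union> S2 \<union> S3) \<le> card (good_sums A B)"
    using finite_good_sums[OF finA, of B] B_eq by (intro card_mono) auto
  have "card S1 + card S2 + card S3 + card E = 2 * card (S1 \<union> S2 \<union> S3) + card (S1 \<inter> S2 \<inter> S3)"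
    using card_three_sets[OF finS] by (simp add: E_def)
  \<comment> \<open>The estimates give \<open>card A \<le> 2 * card (good_sums A B) + 1 + 3\<close>,
    with 1 for the triple and 3 for the corners. By \<open>big\<close> all of them are equalities:
    every corner is occupied, a triple exists, and no selected sum arises only once.\<close>
  then have tight: "card (F1 \<inter> F2) \<noteq> 0" "card (F2 \<inter> F3) \<noteq> 0" "card (F3 \<inter> F1) \<noteq> 0"
    "card (S1 \<inter> S2 \<inter> S3) \<noteq> 0" "card E = 0"
    using big cA cX corners cS cI cU by linarith+
  have "finite E" using finS by (simp add: E_def)
  then have E0: "E = {}" using tight(5) by simp
  obtain c1 c2 c3 where c: "c3 \<in> F1" "c3 \<in> F2" "c1 \<in> F2" "c1 \<in> F3" "c2 \<in> F3" "c2 \<in> F1"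
  proof -
    have "F1 \<inter> F2 \<noteq> {}" "F2 \<inter> F3 \<noteq> {}" "F3 \<inter> F1 \<noteq> {}" using tight(1-3) by auto
    then show ?thesis using that by blast
  qed
  have "S1 \<inter> S2 \<inter> S3 \<noteq> {}" using tight(4) by auto
  then obtain s where s: "s \<in> S1" "s \<in> S2" "s \<in> S3" by blast
  have in_F: "a \<in> F1 \<or> a \<in> F2 \<or> a \<in> F3" if "a \<in> A" for a
    using common_normal_some[OF that] common_normal_b1_face[OF that] r.common_normal_b1_face[OF that] rr.common_normal_b1_face[OF that] c
    unfolding F1_def F2_def F3_def by blast
  \<comment> \<open>Points of \<open>F2\<close> or \<open>F3\<close> share a normal with
    \<open>b1\<close>, so \<open>P1\<close> can only lie in \<open>F1\<close>; the rest is
    cyclic.\<close>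
  have PF: "P1 \<subseteq> F1" "P2 \<subseteq> F2" "P3 \<subseteq> F3"
    using in_F face_w1_common_normal r.face_w1_common_normal rr.face_w1_common_normal
    unfolding P_defs F1_def F2_def F3_def by blast+
  have F_eq: "x \<in> F1 \<Longrightarrow> y \<in> F1 \<Longrightarrow> w1 \<bullet> x = w1 \<bullet> y" "x \<in> F2 \<Longrightarrow> y \<in> F2 \<Longrightarrow> w2 \<bullet> x = w2 \<bullet> y"
    "x \<in> F3 \<Longrightarrow> y \<in> F3 \<Longrightarrow> w3 \<bullet> x = w3 \<bullet> y" for x y
    using face_eq[of x A "- w1" y] face_eq[of x A "- w2" y] face_eq[of x A "- w3" y]
    by (auto simp: F1_def F2_def F3_def)
  have sP: "s - b1 \<in> P1" "s - b2 \<in> P2" "s - b3 \<in> P3" using s S_iff by blast+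
  then have sF: "s - b1 \<in> F1" "s - b2 \<in> F2" "s - b3 \<in> F3" using PF by auto
  have sA: "s - b1 \<in> A" "s - b2 \<in> A" "s - b3 \<in> A" using sP by (auto simp: P_defs)
  have level: "x \<in> S1 \<Longrightarrow> w1 \<bullet> x = w1 \<bullet> s" "x \<in> S2 \<Longrightarrow> w2 \<bullet> x = w2 \<bullet> s" "x \<in> S3 \<Longrightarrow> w3 \<bullet> x = w3 \<bullet> s" for x
    using F_eq(1)[of "x - b1" "s - b1"] F_eq(2)[of "x - b2" "s - b2"] F_eq(3)[of "x - b3" "s - b3"]
      sF PF S_iff by (auto simp: inner_diff_right)
  have xs: "x = s" if "x \<in> S1 \<union> S2 \<union> S3" for x
  proof -
    \<comment> \<open>As no selected sum is simple, \<open>x\<close> agrees with \<open>s\<close> in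
      two of the three \<open>w\<close>-values, which determine a point.\<close>
    have "x \<in> S1 \<inter> S2 \<or> x \<in> S2 \<inter> S3 \<or> x \<in> S3 \<inter> S1" using that E0 unfolding E_def by blast
    then show ?thesis
      using level[of x] dual_eqI[of x s] r.dual_eqI[of x s] rr.dual_eqI[of x s] by blast
  qed
  \<comment> \<open>This shift places the corners at doubled vertices and the three summands of the
    triple at sums of two different vertices.\<close>
  define t where "t = s - b1 - b2 - b3"
  have c3: "c3 = t + (b3 + b3)"
    by (rule dual_eqI) (use F_eq(1)[OF c(1) sF(1)] F_eq(2)[OF c(2) sF(2)] dual in
        \<open>simp_all add: t_def inner_diff_right inner_add_right\<close>)
  have c1: "c1 = t + (b1 + b1)"
    by (rule r.dual_eqI) (use F_eq(2)[OF c(3) sF(2)] F_eq(3)[OF c(4) sF(3)] dual in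
        \<open>simp_all add: t_def inner_diff_right inner_add_right\<close>)
  have c2: "c2 = t + (b2 + b2)"
    by (rule rr.dual_eqI) (use F_eq(3)[OF c(5) sF(3)] F_eq(1)[OF c(6) sF(1)] dual in
        \<open>simp_all add: t_def inner_diff_right inner_add_right\<close>)
  have a123: "s - b1 = t + (b2 + b3)" "s - b2 = t + (b1 + b3)" "s - b3 = t + (b1 + b2)"
    by (simp_all add: t_def)
  have cA': "c1 \<in> A" "c2 \<in> A" "c3 \<in> A"
    using c face_subset unfolding F1_def F2_def F3_def by blast+
  have "A = {c1, c2, c3, s - b1, s - b2, s - b3}"
  proof
    show "{c1, c2, c3, s - b1, s - b2, s - b3} \<subseteq> A" using cA' sA by simp
    show "A \<subseteq> {c1, c2, c3, s - b1, s - b2, s - b3}"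
    proof
      fix a assume "a \<in> A"
      then consider "a \<in> P1" | "a \<in> P2" | "a \<in> P3" | "a \<in> F1 \<inter> F2" | "a \<in> F2 \<inter> F3" | "a \<in> F3 \<inter> F1"
        using A_eq XF by blast
      then show "a \<in> {c1, c2, c3, s - b1, s - b2, s - b3}"
      proof cases
        case 1 then show ?thesis using xs[of "a + b1"] S_iff(1)[of "a + b1"] by auto
      next
        case 2 then show ?thesis using xs[of "a + b2"] S_iff(2)[of "a + b2"] by auto
      next
        case 3 then show ?thesis using xs[of "a + b3"] S_iff(3)[of "a + b3"] by auto
      next
        case 4 then show ?thesis using dual_eqI[OF F_eq(1)[of a c3] F_eq(2)[of a c3]] c by blast
      next
        case 5 then show ?thesis using r.dual_eqI[OF F_eq(2)[of a c1] F_eq(3)[of a c1]] c by blast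
      next
        case 6 then show ?thesis using rr.dual_eqI[OF F_eq(3)[of a c2] F_eq(1)[of a c2]] c by blast
      qed
    qed
  qed
  also have "\<dots> = (\<lambda>y. t + y) ` {b1 + b1, b2 + b2, b3 + b3, b2 + b3, b1 + b3, b1 + b2}"
    unfolding c1 c2 c3 a123 by simp
  also have "{b1 + b1, b2 + b2, b3 + b3, b2 + b3, b1 + b3, b1 + b2} = B + B"
    by (auto simp: B_eq set_plus_def add.commute)
  finally show ?thesis by blast
qed

end

section \<open>Barycentric gradients and combination of the cases\<close>

text \<open>The gradients are the edge vectors turned by a right angle and divided by
  \<open>D\<close>, twice the signed area. After multiplication by \<open>D\<close> each claim is a
  polynomial identity.\<close>

lemma dual_frame_exists:
  fixes b1 b2 b3 :: "real^2"
  assumes "\<not> collinear {b1, b2, b3}"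
  obtains w1 w2 w3 where "w1 + w2 + w3 = 0"
    "w1 \<bullet> b1 = w1 \<bullet> b2 + 1" "w1 \<bullet> b3 = w1 \<bullet> b2"
    "w2 \<bullet> b2 = w2 \<bullet> b3 + 1" "w2 \<bullet> b1 = w2 \<bullet> b3"
    "w3 \<bullet> b3 = w3 \<bullet> b1 + 1" "w3 \<bullet> b2 = w3 \<bullet> b1"
    "\<And>u. u = (u \<bullet> b1) *\<^sub>R w1 + (u \<bullet> b2) *\<^sub>R w2 + (u \<bullet> b3) *\<^sub>R w3"
proof -
  define D where "D = perp (b2 - b1) \<bullet> (b3 - b1)"
  have "b1 \<noteq> b2" using assms by auto
  then have "perp (b2 - b1) \<noteq> 0" by simp
  then obtain x y where xy: "x \<in> {b1, b2, b3}" "y \<in> {b1, b2, b3}" "perp (b2 - b1) \<bullet> x < perp (b2 - b1) \<bullet> y"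
    using noncollinear_not_constant[OF assms] by metis
  have "perp (b2 - b1) \<bullet> b2 = perp (b2 - b1) \<bullet> b1" by (simp add: inner_real2 algebra_simps)
  then have D: "D \<noteq> 0" using xy by (auto simp: D_def inner_diff_right)
  have D': "D = (b2 $ 1 - b1 $ 1) * (b3 $ 2 - b1 $ 2) - (b2 $ 2 - b1 $ 2) * (b3 $ 1 - b1 $ 1)"
    by (simp add: D_def inner_real2 algebra_simps)
  define w1 w2 w3 where "w1 = (1 / D) *\<^sub>R perp (b3 - b2)" and "w2 = (1 / D) *\<^sub>R perp (b1 - b3)"
    and "w3 = (1 / D) *\<^sub>R perp (b2 - b1)"
  have sum0: "w1 + w2 + w3 = 0"
    by (simp add: w1_def w2_def w3_def vec_eq_iff forall_2 diff_divide_distrib)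
  have scaled: "D *\<^sub>R w1 = perp (b3 - b2)" "D *\<^sub>R w2 = perp (b1 - b3)" "D *\<^sub>R w3 = perp (b2 - b1)"
    using D by (simp_all add: w1_def w2_def w3_def)
  have one: "w \<bullet> x = w \<bullet> y + 1" if "D *\<^sub>R w = p" "p \<bullet> (x - y) = D" for w x y p
  proof -
    have "D * (w \<bullet> (x - y)) = D" using that by (metis inner_scaleR_left)
    then show ?thesis using D by (simp add: inner_diff_right)
  qed
  have zero: "w \<bullet> x = w \<bullet> y" if "D *\<^sub>R w = p" "p \<bullet> (x - y) = 0" for w x y p
  proof -
    have "D * (w \<bullet> (x - y)) = 0" using that by (metis inner_scaleR_left)
    then show ?thesis using D by (simp add: inner_diff_right)
  qed
  have rep: "u = (u \<bullet> b1) *\<^sub>R w1 + (u \<bullet> b2) *\<^sub>R w2 + (u \<bullet> b3) *\<^sub>R w3" for u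
  proof -
    have "D *\<^sub>R u = (u \<bullet> b1) *\<^sub>R (D *\<^sub>R w1) + (u \<bullet> b2) *\<^sub>R (D *\<^sub>R w2) + (u \<bullet> b3) *\<^sub>R (D *\<^sub>R w3)"
      unfolding scaled by (simp add: D' vec_eq_iff forall_2 inner_real2 algebra_simps)
    also have "\<dots> = D *\<^sub>R ((u \<bullet> b1) *\<^sub>R w1 + (u \<bullet> b2) *\<^sub>R w2 + (u \<bullet> b3) *\<^sub>R w3)"
      by (simp add: algebra_simps)
    finally show ?thesis using D by (simp only: real_vector.scale_left_imp_eq[OF D])
  qed
  show ?thesis
    by (rule that[OF sum0 one[OF scaled(1)] zero[OF scaled(1)] one[OF scaled(2)] zero[OF scaled(2)]
          one[OF scaled(3)] zero[OF scaled(3)] rep])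
      (simp_all add: D' inner_real2 algebra_simps)
qed

lemma few_interior_sums_imp_translate:
  assumes fin: "finite A" "finite B" and nc: "\<not> collinear A" "\<not> collinear B"
    and bd: "card A = boundary_count A" "card B = boundary_count B"
    and few: "2 * interior_count (A + B) + 6 < card A + card B" and le: "card B \<le> card A"
  shows "card B = 3 \<and> is_translate_of A (B + B)"
proof -
  have frA: "\<exists>u. u \<noteq> 0 \<and> x \<in> face A u" if "x \<in> A" for x
    using frontier_point_face[OF fin(1) bd(1) that] by metis
  have frB: "\<exists>u. u \<noteq> 0 \<and> x \<in> face B u" if "x \<in> B" for x
    using frontier_point_face[OF fin(2) bd(2) that] by metis
  have G: "2 * card (good_sums A B) + 6 < card A + card B"
    using card_good_sums_le_interior_count[OF fin] few by linarith
  have small: "card (face B u) \<le> 2" if u: "u \<noteq> 0" for u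
  proof (rule ccontr)
    assume "\<not> ?thesis"
    then have p: "card (face B u) \<ge> 3" by simp
    have 1: "card (face B u) + card A \<le> card (good_sums A B) + card (face A u) + 3"
      using good_sums_edge_bound[OF fin(2,1) nc(2,1) u p] by (simp add: good_sums_commute)
    \<comment> \<open>If both parallel faces have three points, the two edge bounds add up with the
      face sizes cancelling. Otherwise the face of \<open>A\<close> has at most two points, and
      \<open>card B \<le> card A\<close> closes the gap.\<close>
    show False
    proof (cases "card (face A u) \<ge> 3")
      case True
      then show False using 1 good_sums_edge_bound[OF fin nc u True] G by linarith
    next
      case False
      then show False using 1 p le G by linarith
    qed
  qed
  have "card B < 4"
    using good_sums_bound_polygon[OF fin nc small frB] G by linarith
  moreover have "card B \<ge> 3"
  proof (rule ccontr)
    assume "\<not> ?thesis"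
    then have "card B \<le> 2" by simp
    then show False using collinear_small[OF fin(2)] nc(2) by blast
  qed
  ultimately have three: "card B = 3" by simp
  then obtain b1 b2 b3 where B: "B = {b1, b2, b3}" by (metis card_3_iff)
  obtain w1 w2 w3 where w: "w1 + w2 + w3 = 0"
    "w1 \<bullet> b1 = w1 \<bullet> b2 + 1" "w1 \<bullet> b3 = w1 \<bullet> b2"
    "w2 \<bullet> b2 = w2 \<bullet> b3 + 1" "w2 \<bullet> b1 = w2 \<bullet> b3"
    "w3 \<bullet> b3 = w3 \<bullet> b1 + 1" "w3 \<bullet> b2 = w3 \<bullet> b1"
    "\<And>u. u = (u \<bullet> b1) *\<^sub>R w1 + (u \<bullet> b2) *\<^sub>R w2 + (u \<bullet> b3) *\<^sub>R w3"
    using dual_frame_exists[of b1 b2 b3] nc(2) B by metis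
  interpret triangle_summand A B b1 b2 b3 w1 w2 w3
    by unfold_locales (fact B w fin nc frA)+
  have "card A > 2 * card (good_sums A B) + 3" using G three by linarith
  then have "\<exists>t. A = (\<lambda>y. t + y) ` (B + B)" by (rule good_sums_bound_triangle)
  then show ?thesis using three by (simp add: is_translate_of_def)
qed

theorem theorem5p1:
  fixes A B :: "(real^2) set"
  assumes "finite A" and "finite B"
    and "\<not> collinear A" and "\<not> collinear B"
    and "card A = boundary_count A" and "card B = boundary_count B"
    and "\<not> (2 * int (interior_count (A + B))
               \<ge> int (boundary_count A) + int (boundary_count B) - 6)"
  shows "(card A = 3 \<and> is_translate_of B (A + A)) \<or>
         (card B = 3 \<and> is_translate_of A (B + B))"
proof -
  have few: "2 * interior_count (A + B) + 6 < card A + card B"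
    using assms(5-7) by linarith
  then have few': "2 * interior_count (B + A) + 6 < card B + card A"
    by (simp add: add.commute)
  show ?thesis
  proof (cases "card B \<le> card A")
    case True
    then show ?thesis using few_interior_sums_imp_translate assms few by blast
  next
    case False
    then show ?thesis using few_interior_sums_imp_translate[of B A] assms few' by auto
  qed
qed

end
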